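(* Let $K=\mathbb{Q}(\theta)\subset\mathbb{R}$ be a cubic number field generated by a real algebraic integer $\theta$, let $d\ge 2$, and let $V=(v_1,\ldots,v_d)$, $v_j=[a_j:b_j]\in\mathbb{P}^1(\mathbb{Q})$, be a rational projective coefficient configuration of size $d$ with canonical primitive integer representatives $(a_j,b_j)$. Put $\alpha_j=a_j\theta+b_j\theta^2$ for $j=1,\ldots,d$, let $\boldsymbol{x}_n=(\{n\alpha_1\},\ldots,\{n\alpha_d\})\in[0,1)^d$ for $n\ge 0$, and let $\mathcal{K}_N(K,V)=(\boldsymbol{x}_n)_{n=0}^{N-1}$. Then every two-dimensional coordinate projection of the sequence $(\boldsymbol{x}_n)_{n\ge0}$ is quasi-uniform in the Euclidean unit square. More precisely, there exist constants $c_{K,V},C_{K,V}>0$ such that, for all $N\ge 2$ and all $1\le i<j\le d$, \[ q_{ij}(\mathcal{K}_N(K,V))\ge c_{K,V}N^{-1/2}\quad\text{and}\quad h_{ij}(\mathcal{K}_N(K,V))\le C_{K,V}N^{-1/2}. \] In particular, \[ \sup_{N\ge2}\max_{1\le i<j\le d}\rho_{ij}(\mathcal{K}_N(K,V))<\infty . \]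
   Context: $\{\cdot\}$ denotes the fractional part. A rational projective coefficient configuration of size $d$ is an ordered tuple $V=(v_1,\ldots,v_d)$ of pairwise distinct points $v_j\in\mathbb{P}^1(\mathbb{Q})=(\mathbb{Q}^2\setminus\{(0,0)\})/\mathbb{Q}^\times$. Each $v_j=[a_j:b_j]$ is represented by its canonical primitive integer representative: $a_j,b_j\in\mathbb{Z}$, $\gcd(a_j,b_j)=1$, and either $a_j>0$ or $(a_j,b_j)=(0,1)$. Distinctness means $a_ib_j-a_jb_i\neq0$ for $i\ne j$. For a finite indexed family $P=(\boldsymbol{y}_n)_{n=0}^{N-1}\subset[0,1)^s$ (repetitions retained), define \[ h(P)=\sup_{\boldsymbol{y}\in[0,1)^s}\min_{0\le n<N}\|\boldsymbol{y}-\boldsymbol{y}_n\|_2,\quad q(P)=\tfrac12\min_{0\le m<n<N}\|\boldsymbol{y}_m-\boldsymbol{y}_n\|_2,\quad \rho(P)=h(P)/q(P), \] with $q(P)=0$ and $\rho(P)=\infty$ if two labeled points coincide. For an indexed family $P\subset[0,1)^d$ and $i<j$, let $P^{(i,j)}\subset[0,1)^2$ be the indexed projection onto coordinates $i$ and $j$, and write $h_{ij}(P)=h(P^{(i,j)})$, $q_{ij}(P)=q(P^{(i,j)})$, $\rho_{ij}(P)=\rho(P^{(i,j)})$. A sequence of finite families is quasi-uniform if its mesh ratios $\rho$ are bounded; a sequence of points (or its projection) is called quasi-uniform if its initial segments of length $N\ge2$ are. *)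

theory Defs
  imports
    "HOL-Analysis.Analysis"
    "HOL-Algebra.Generated_Fields"
    "HOL-Algebra.Embedded_Algebras"
    "HOL-Algebra.Algebraic_Closure_Type"
begin

section \<open>Real cubic number fields\<close>

abbreviation real_field :: "real ring" where
  "real_field \<equiv> ring_of_type_algebra"

definition rat_adjoin :: "real \<Rightarrow> real set" where
  "rat_adjoin \<theta> = generate_field real_field (\<rat> \<union> {\<theta>})"

definition cubic_number_field :: "real set \<Rightarrow> bool" where
  "cubic_number_field K \<longleftrightarrow> subfield K real_field \<and> ring.dimension real_field 3 \<rat> K"

lemma subfield_Rats: "subfield \<rat> real_field"
proof -
  interpret F: field real_field by (rule field_from_type_algebra)
  have ops: "carrier real_field = UNIV" "\<one>\<^bsub>real_field\<^esub> = 1" "\<zero>\<^bsub>real_field\<^esub> = 0"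
    "x \<otimes>\<^bsub>real_field\<^esub> y = x * y" "x \<oplus>\<^bsub>real_field\<^esub> y = x + y" for x y
    by (simp_all add: ring_of_type_algebra_def)
  have minus: "\<ominus>\<^bsub>real_field\<^esub> x = - x" for x
    by (rule F.minus_equality) (simp_all add: ops)
  have inv: "inv\<^bsub>real_field\<^esub> x = inverse x" if "x \<noteq> 0" for x
    using that by (intro F.comm_inv_char) (simp_all add: ops)
  have "subring \<rat> real_field"
    by (rule F.subringI) (simp_all add: ops minus)
  then show ?thesis
    by (rule F.subfieldI') (auto simp: ops inv)
qed


section \<open>The rational projective line\<close>

definition proj_rel :: "((rat \<times> rat) \<times> (rat \<times> rat)) set" where
  "proj_rel = {(u, w). u \<noteq> (0, 0) \<and> w \<noteq> (0, 0) \<and>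
     (\<exists>c. c \<noteq> 0 \<and> w = (c * fst u, c * snd u))}"

definition rat_proj_line :: "(rat \<times> rat) set set" where
  "rat_proj_line = (UNIV - {(0, 0)}) // proj_rel"

text \<open>The point with homogeneous coordinates \<open>[a : b]\<close>; meaningful for \<open>(a, b) \<noteq> (0, 0)\<close>.\<close>
definition proj_point :: "rat \<Rightarrow> rat \<Rightarrow> (rat \<times> rat) set" where
  "proj_point a b = proj_rel `` {(a, b)}"

definition canonical_rep :: "(rat \<times> rat) set \<Rightarrow> int \<Rightarrow> int \<Rightarrow> bool" where
  "canonical_rep v a b \<longleftrightarrow>
     v = proj_point (of_int a) (of_int b) \<and> gcd a b = 1 \<and> (a > 0 \<or> (a, b) = (0, 1))"

text \<open>A tuple \<open>(v\<^sub>1, \<dots>, v\<^sub>d)\<close> is a function on \<open>nat\<close>, of which only the values on \<open>{1..d}\<close> matter.\<close>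
definition rat_proj_config :: "nat \<Rightarrow> (nat \<Rightarrow> (rat \<times> rat) set) \<Rightarrow> bool" where
  "rat_proj_config d V \<longleftrightarrow> V ` {1..d} \<subseteq> rat_proj_line \<and> inj_on V {1..d}"

lemma equiv_proj_rel: "equiv (UNIV - {(0, 0)}) proj_rel"
proof (rule equivI)
  show "proj_rel \<subseteq> (UNIV - {(0, 0)}) \<times> (UNIV - {(0, 0)})"
    by (auto simp: proj_rel_def)
  show "refl_on (UNIV - {(0, 0)}) proj_rel"
    by (auto simp: refl_on_def proj_rel_def intro!: exI[of _ 1])
  show "sym proj_rel"
  proof (rule symI)
    fix u w assume "(u, w) \<in> proj_rel"
    then obtain c where "u \<noteq> (0, 0)" "w \<noteq> (0, 0)" "c \<noteq> 0" "w = (c * fst u, c * snd u)"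
      unfolding proj_rel_def by blast
    then show "(w, u) \<in> proj_rel"
      by (auto simp: proj_rel_def intro!: exI[of _ "1 / c"])
  qed
  show "trans proj_rel"
  proof (rule transI)
    fix u w z assume "(u, w) \<in> proj_rel" "(w, z) \<in> proj_rel"
    then obtain c e where "u \<noteq> (0, 0)" "z \<noteq> (0, 0)" "c \<noteq> 0" "e \<noteq> 0"
      "w = (c * fst u, c * snd u)" "z = (e * fst w, e * snd w)"
      unfolding proj_rel_def by blast
    then show "(u, z) \<in> proj_rel"
      by (auto simp: proj_rel_def intro!: exI[of _ "e * c"])
  qed
qed

lemma proj_point_eq_iff:
  assumes "(a, b) \<noteq> (0, 0)" "(a', b') \<noteq> (0, 0)"
  shows "proj_point a b = proj_point a' b' \<longleftrightarrow> a * b' = a' * b"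
proof -
  have "proj_point a b = proj_point a' b' \<longleftrightarrow> ((a, b), (a', b')) \<in> proj_rel"
    unfolding proj_point_def using assms
    by (intro eq_equiv_class_iff[OF equiv_proj_rel]) auto
  also have "\<dots> \<longleftrightarrow> a * b' = a' * b"
  proof
    assume "((a, b), (a', b')) \<in> proj_rel"
    then show "a * b' = a' * b" by (auto simp: proj_rel_def)
  next
    assume eq: "a * b' = a' * b"
    show "((a, b), (a', b')) \<in> proj_rel"
    proof (cases "a = 0")
      case True
      with eq assms have "b \<noteq> 0" "a' = 0" "b' \<noteq> 0" by auto
      with True show ?thesis
        by (auto simp: proj_rel_def intro!: exI[of _ "b' / b"])
    next
      case False
      with eq assms have "a' \<noteq> 0" by auto
      with False eq show ?thesis
        by (auto simp: proj_rel_def field_simps intro!: exI[of _ "a' / a"])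
    qed
  qed
  finally show ?thesis .
qed

lemma canonical_rep_unique:
  assumes "canonical_rep v a b" "canonical_rep v a' b'"
  shows "a = a' \<and> b = b'"
proof -
  have nz: "(a, b) \<noteq> (0, 0)" "(a', b') \<noteq> (0, 0)"
    using assms by (auto simp: canonical_rep_def)
  have "rat_of_int a * of_int b' = of_int a' * of_int b"
    using assms nz by (subst proj_point_eq_iff[symmetric]) (auto simp: canonical_rep_def)
  then have eq: "a * b' = a' * b"
    by (metis of_int_eq_iff of_int_mult)
  have cop: "coprime a b" "coprime a' b'"
    using assms by (auto simp: canonical_rep_def coprime_iff_gcd_eq_1)
  have "a dvd a' * b" "a' dvd a * b'"
    using eq by (metis dvd_triv_left)+
  then have "a dvd a'" "a' dvd a"
    using cop by (auto simp: coprime_dvd_mult_left_iff)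
  moreover have "a \<ge> 0" "a' \<ge> 0"
    using assms by (auto simp: canonical_rep_def)
  ultimately have "a = a'" by (simp add: zdvd_antisym_nonneg)
  with eq assms show ?thesis by (auto simp: canonical_rep_def)
qed

lemma canonical_rep_exists:
  assumes "v \<in> rat_proj_line"
  shows "\<exists>a b. canonical_rep v a b"
proof -
  obtain r s where v: "v = proj_point r s" and nz: "(r, s) \<noteq> (0, 0)"
    using assms by (auto simp: rat_proj_line_def proj_point_def elim!: quotientE)
  obtain p q where pq: "quotient_of (s / r) = (p, q)" by fastforce
  then have "q > 0" "coprime p q" "s / r = of_int p / of_int q"
    by (auto simp: quotient_of_denom_pos quotient_of_coprime quotient_of_div)
  then show ?thesis
  proof (cases "r = 0")
    case True
    with nz have "proj_point r s = proj_point 0 1" by (subst proj_point_eq_iff) auto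
    then have "canonical_rep v 0 1" by (simp add: canonical_rep_def v)
    then show ?thesis by blast
  next
    case False
    have "proj_point r s = proj_point (of_int q) (of_int p)"
      using \<open>q > 0\<close> \<open>s / r = _\<close> False nz
      by (subst proj_point_eq_iff) (auto simp: field_simps)
    then have "canonical_rep v q p"
      using \<open>q > 0\<close> \<open>coprime p q\<close> by (simp add: canonical_rep_def v gcd.commute)
    then show ?thesis by blast
  qed
qed

text \<open>Distinctness of projective points, in terms of the canonical representatives.\<close>
lemma canonical_rep_distinct_iff:
  assumes "canonical_rep v a b" "canonical_rep w a' b'"
  shows "v \<noteq> w \<longleftrightarrow> a * b' - a' * b \<noteq> 0"
proof -
  have "v = w \<longleftrightarrow> rat_of_int a * of_int b' = of_int a' * of_int b"
    using assms by (subst proj_point_eq_iff[symmetric]) (auto simp: canonical_rep_def)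
  also have "\<dots> \<longleftrightarrow> a * b' = a' * b"
    by (metis of_int_eq_iff of_int_mult)
  finally show ?thesis by simp
qed


section \<open>Finite families of points and their mesh ratios\<close>

text \<open>A finite indexed family of \<open>N\<close> points is a list of length \<open>N\<close>, so that repetitions are retained.
  The ambient space is an arbitrary Euclidean space; below it is \<open>real \<times> real\<close>,
  whose product metric in the library is the Euclidean one.\<close>

definition unit_cube :: "'a::euclidean_space set" where
  "unit_cube = {y. \<forall>b\<in>Basis. 0 \<le> y \<bullet> b \<and> y \<bullet> b < 1}"

lemma unit_cube_prod: "unit_cube = {0..<1::real} \<times> {0..<1::real}"
  by (auto simp: unit_cube_def Basis_prod_def)

definition fill_dist :: "'a::euclidean_space list \<Rightarrow> real" where
  "fill_dist P = (SUP y\<in>unit_cube. Min {dist y (P ! n) | n. n < length P})"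

definition sep_radius :: "'a::euclidean_space list \<Rightarrow> real" where
  "sep_radius P = 1 / 2 * Min {dist (P ! m) (P ! n) | m n. m < n \<and> n < length P}"

definition mesh_ratio :: "'a::euclidean_space list \<Rightarrow> ereal" where
  "mesh_ratio P = (if sep_radius P = 0 then \<infinity> else ereal (fill_dist P / sep_radius P))"

definition initial_segment :: "(nat \<Rightarrow> 'a) \<Rightarrow> nat \<Rightarrow> 'a list" where
  "initial_segment x N = map x [0..<N]"

definition quasi_uniform :: "(nat \<Rightarrow> 'a::euclidean_space) \<Rightarrow> bool" where
  "quasi_uniform x \<longleftrightarrow> (\<exists>B::real. \<forall>N\<ge>2. mesh_ratio (initial_segment x N) \<le> ereal B)"

text \<open>Points of \<open>[0,1)\<^sup>d\<close> for varying \<open>d\<close> are functions on the index set \<open>{1..d}\<close>.\<close>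

definition coord_proj :: "nat \<Rightarrow> nat \<Rightarrow> (nat \<Rightarrow> real) \<Rightarrow> real \<times> real" where
  "coord_proj i j x = (x i, x j)"

definition fill_dist_proj :: "nat \<Rightarrow> nat \<Rightarrow> (nat \<Rightarrow> real) list \<Rightarrow> real" where
  "fill_dist_proj i j P = fill_dist (map (coord_proj i j) P)"

definition sep_radius_proj :: "nat \<Rightarrow> nat \<Rightarrow> (nat \<Rightarrow> real) list \<Rightarrow> real" where
  "sep_radius_proj i j P = sep_radius (map (coord_proj i j) P)"

definition mesh_ratio_proj :: "nat \<Rightarrow> nat \<Rightarrow> (nat \<Rightarrow> real) list \<Rightarrow> ereal" where
  "mesh_ratio_proj i j P = mesh_ratio (map (coord_proj i j) P)"


section \<open>The Kronecker sequence of a configuration\<close>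

definition kron_coeff :: "real \<Rightarrow> int \<Rightarrow> int \<Rightarrow> real" where
  "kron_coeff \<theta> a b = of_int a * \<theta> + of_int b * \<theta>\<^sup>2"

definition kron_point ::
    "real \<Rightarrow> nat \<Rightarrow> (nat \<Rightarrow> int) \<Rightarrow> (nat \<Rightarrow> int) \<Rightarrow> nat \<Rightarrow> nat \<Rightarrow> real" where
  "kron_point \<theta> d a b n = (\<lambda>j\<in>{1..d}. frac (of_nat n * kron_coeff \<theta> (a j) (b j)))"

definition kron_set ::
    "real \<Rightarrow> nat \<Rightarrow> (nat \<Rightarrow> int) \<Rightarrow> (nat \<Rightarrow> int) \<Rightarrow> nat \<Rightarrow> (nat \<Rightarrow> real) list" where
  "kron_set \<theta> d a b N = initial_segment (kron_point \<theta> d a b) N"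

end

theory Submission
  imports Defs "HOL-Analysis.Kronecker_Approximation_Theorem"
begin

text \<open>
  The two bounds are statements about the integer vectors \<open>(k, p, q)\<close> near the line spanned by
  \<open>(1, \<theta>, \<theta>\<^sup>2)\<close>, that is, with small errors \<open>k \<theta> - p\<close> and
  \<open>k \<theta>\<^sup>2 - q\<close>. The cubic field acts on such vectors: a multiple of the matrix of
  multiplication by \<open>\<theta>\<close> is an integer matrix having this line as an eigenline. Hence it maps an
  integer vector with denominator \<open>k\<close> and errors at most \<open>\<epsilon>\<close> to another one whose
  denominator and errors are of the same order (\<open>companion_step\<close>). Since \<open>1\<close>, \<open>\<theta>\<close>,
  \<open>\<theta>\<^sup>2\<close> are independent over the rationals, a nonzero integer vector and its first two images
  are always linearly independent (\<open>det3_companion_nonzero\<close>). One good approximation therefore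
  comes with three independent ones of comparable quality.

  Separation: the determinant of these three vectors is a nonzero integer, but it is
  \<open>O(k \<epsilon>\<^sup>2)\<close>. So \<open>\<epsilon>\<close> is at least a constant times \<open>k powr (- 1 / 2)\<close>
  (\<open>badly_approximable\<close>). Differences of points of the sequence with indices below \<open>N\<close> are such
  errors with \<open>k < N\<close>.

  Covering: Dirichlet's theorem on simultaneous approximation provides one vector with
  \<open>k \<le> N\<close> and \<open>\<epsilon> \<le> N powr (- 1 / 2)\<close> up to constants. The three independent
  vectors obtained from it generate a lattice whose cells have this size, so every target point is
  approximated with error \<open>O(N powr (- 1 / 2))\<close> by some \<open>n < N\<close> (\<open>covering\<close>).

  An arbitrary pair of coefficients arises from \<open>(\<theta>, \<theta>\<^sup>2)\<close> by an integer matrix, which is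
  nonsingular because the two projective points are distinct. Both bounds survive this change of
  variables with other constants (\<open>pair_badly_approximable\<close>, \<open>pair_covering\<close>).
\<close>

section \<open>Determinants of three vectors\<close>

fun det3 :: "'a::comm_ring_1 \<times> 'a \<times> 'a \<Rightarrow> 'a \<times> 'a \<times> 'a \<Rightarrow> 'a \<times> 'a \<times> 'a \<Rightarrow> 'a" where
  "det3 (a1, a2, a3) (b1, b2, b3) (c1, c2, c3) =
     a1 * (b2 * c3 - b3 * c2) - a2 * (b1 * c3 - b3 * c1) + a3 * (b1 * c2 - b2 * c1)"

fun dot3 :: "'a::comm_ring_1 \<times> 'a \<times> 'a \<Rightarrow> 'a \<times> 'a \<times> 'a \<Rightarrow> 'a" where
  "dot3 (a1, a2, a3) (b1, b2, b3) = a1 * b1 + a2 * b2 + a3 * b3"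

fun crs3 :: "'a::comm_ring_1 \<times> 'a \<times> 'a \<Rightarrow> 'a \<times> 'a \<times> 'a \<Rightarrow> 'a \<times> 'a \<times> 'a" where
  "crs3 (a1, a2, a3) (b1, b2, b3) = (a2 * b3 - a3 * b2, a3 * b1 - a1 * b3, a1 * b2 - a2 * b1)"

lemma dot3_commute: "dot3 x y = dot3 y x"
  by (cases x; cases y) (simp add: mult.commute)

text \<open>The vector \<open>x\<close> is orthogonal to the whole line of \<open>u\<close>, since a vanishing cross product
  with \<open>u\<close> says that \<open>w\<close> is parallel to \<open>u\<close>. This is the rank one case of the next lemma.\<close>
lemma orthogonal_exists:
  fixes u :: "'a::idom \<times> 'a \<times> 'a"
  assumes "u \<noteq> (0, 0, 0)"
  shows "\<exists>x. x \<noteq> (0, 0, 0) \<and> dot3 u x = 0 \<and> (\<forall>w. crs3 u w = (0, 0, 0) \<longrightarrow> dot3 w x = 0)"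
proof (cases u)
  case (fields a b c)
  show ?thesis
  proof (cases "a = 0 \<and> b = 0")
    case True
    with fields assms have "c \<noteq> 0" by auto
    with True fields show ?thesis by (intro exI[of _ "(1, 0, 0)"]) auto
  next
    case False
    with fields show ?thesis by (intro exI[of _ "(b, - a, 0)"]) (auto simp: algebra_simps)
  qed
qed

text \<open>A singular matrix over a domain kills a nonzero vector with entries in the same domain, so
  that no denominators appear. A cross product of two rows is orthogonal to those two rows, and to
  the third one because the determinant vanishes. Only when all cross products vanish, that is,
  when the rows are parallel, does another vector have to be found.\<close>
lemma det3_zero_imp_kernel:
  fixes u v w :: "'a::idom \<times> 'a \<times> 'a"
  assumes "det3 u v w = 0"
  obtains x where "x \<noteq> (0, 0, 0)" "dot3 u x = 0" "dot3 v x = 0" "dot3 w x = 0"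
proof -
  obtain u1 u2 u3 v1 v2 v3 w1 w2 w3
    where eq: "u = (u1, u2, u3)" "v = (v1, v2, v3)" "w = (w1, w2, w3)"
    by (metis prod_cases3)
  have crs: "dot3 u (crs3 v w) = 0" "dot3 v (crs3 v w) = 0" "dot3 w (crs3 v w) = 0"
    "dot3 u (crs3 u w) = 0" "dot3 v (crs3 u w) = 0" "dot3 w (crs3 u w) = 0"
    "dot3 u (crs3 u v) = 0" "dot3 v (crs3 u v) = 0" "dot3 w (crs3 u v) = 0"
    using assms unfolding eq by (simp_all add: algebra_simps)
  show thesis
  proof (cases "crs3 v w = (0, 0, 0) \<and> crs3 u w = (0, 0, 0) \<and> crs3 u v = (0, 0, 0)")
    case False
    with crs that show ?thesis by metis
  next
    case par: True
    show ?thesis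
    proof (cases "u = (0, 0, 0)")
      case False
      then show ?thesis using orthogonal_exists[of u] par that by blast
    next
      case u0: True
      show ?thesis
      proof (cases "v = (0, 0, 0)")
        case False
        then show ?thesis using orthogonal_exists[of v] par that u0
          by (metis dot3.simps add_0 mult_zero_left prod_cases3)
      next
        case v0: True
        show ?thesis
        proof (cases "w = (0, 0, 0)")
          case False
          then show ?thesis using orthogonal_exists[of w] that u0 v0
            by (metis dot3.simps add_0 mult_zero_left prod_cases3)
        next
          case True
          with u0 v0 that[of "(1, 0, 0)"] show ?thesis by simp
        qed
      qed
    qed
  qed
qed

lemma det3_transpose:
  "det3 (a1, a2, a3) (b1, b2, b3) (c1, c2, c3) = det3 (a1, b1, c1) (a2, b2, c2) (a3, b3, c3)"
  by (simp add: algebra_simps)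


text \<open>The converse: multiplication by the adjugate matrix gives \<open>det3 u v w\<close> times each
  coordinate of \<open>x\<close> as a combination of the three dot products.\<close>
lemma kernel_imp_det3_zero:
  fixes u v w x :: "'a::idom \<times> 'a \<times> 'a"
  assumes "dot3 u x = 0" "dot3 v x = 0" "dot3 w x = 0" "x \<noteq> (0, 0, 0)"
  shows "det3 u v w = 0"
proof -
  obtain u1 u2 u3 v1 v2 v3 w1 w2 w3 x1 x2 x3
    where eq: "u = (u1, u2, u3)" "v = (v1, v2, v3)" "w = (w1, w2, w3)" "x = (x1, x2, x3)"
    by (metis prod_cases3)
  have "det3 u v w * x1 = (v2 * w3 - v3 * w2) * dot3 u x - (u2 * w3 - u3 * w2) * dot3 v x
      + (u2 * v3 - u3 * v2) * dot3 w x"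
    "det3 u v w * x2 = - (v1 * w3 - v3 * w1) * dot3 u x + (u1 * w3 - u3 * w1) * dot3 v x
      - (u1 * v3 - u3 * v1) * dot3 w x"
    "det3 u v w * x3 = (v1 * w2 - v2 * w1) * dot3 u x - (u1 * w2 - u2 * w1) * dot3 v x
      + (u1 * v2 - u2 * v1) * dot3 w x"
    unfolding eq by (simp_all add: algebra_simps)
  with assms show ?thesis by (auto simp: eq)
qed

text \<open>Passing from an integer vector \<open>(k, p, q)\<close> to \<open>k\<close> and the two approximation errors
  \<open>k x - p\<close> and \<open>k y - q\<close> is a column operation. Thus an integer determinant can be
  estimated through the errors; the two sign changes cancel.\<close>
lemma det3_shear:
  "det3 (k1, p1, q1) (k2, p2, q2) (k3, p3, q3)
   = det3 (k1, k1 * x - p1, k1 * y - q1) (k2, k2 * x - p2, k2 * y - q2) (k3, k3 * x - p3, k3 * y - q3)"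
  by (simp add: algebra_simps)

lemma det3_bound:
  fixes K \<epsilon> :: real
  assumes "\<bar>k1\<bar> \<le> K" "\<bar>k2\<bar> \<le> K" "\<bar>k3\<bar> \<le> K"
    and "\<bar>x1\<bar> \<le> \<epsilon>" "\<bar>x2\<bar> \<le> \<epsilon>" "\<bar>x3\<bar> \<le> \<epsilon>" "\<bar>y1\<bar> \<le> \<epsilon>" "\<bar>y2\<bar> \<le> \<epsilon>" "\<bar>y3\<bar> \<le> \<epsilon>"
  shows "\<bar>det3 (k1, x1, y1) (k2, x2, y2) (k3, x3, y3)\<bar> \<le> 6 * K * \<epsilon>\<^sup>2"
proof -
  have e: "0 \<le> \<epsilon>" and K: "0 \<le> K" using assms by linarith+
  have summand: "\<bar>k * (x * y)\<bar> \<le> K * \<epsilon>\<^sup>2" if "\<bar>k\<bar> \<le> K" "\<bar>x\<bar> \<le> \<epsilon>" "\<bar>y\<bar> \<le> \<epsilon>" for k x y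
    unfolding abs_mult power2_eq_square using that e K by (intro mult_mono) auto
  have "det3 (k1, x1, y1) (k2, x2, y2) (k3, x3, y3) =
    k1 * (x2 * y3) - k1 * (y2 * x3) - k2 * (x1 * y3) + k3 * (x1 * y2) + k2 * (y1 * x3) - k3 * (y1 * x2)"
    by (simp add: algebra_simps)
  also have "\<bar>\<dots>\<bar> \<le> \<bar>k1 * (x2 * y3)\<bar> + \<bar>k1 * (y2 * x3)\<bar> + \<bar>k2 * (x1 * y3)\<bar> + \<bar>k3 * (x1 * y2)\<bar>
      + \<bar>k2 * (y1 * x3)\<bar> + \<bar>k3 * (y1 * x2)\<bar>" by linarith
  also have "\<dots> \<le> K * \<epsilon>\<^sup>2 + K * \<epsilon>\<^sup>2 + K * \<epsilon>\<^sup>2 + K * \<epsilon>\<^sup>2 + K * \<epsilon>\<^sup>2 + K * \<epsilon>\<^sup>2"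
    using assms by (intro add_mono summand)
  finally show ?thesis by simp
qed

lemma cramer3:
  fixes k1 :: "'a::field"
  assumes "det3 (k1, x1, y1) (k2, x2, y2) (k3, x3, y3) \<noteq> 0"
  obtains l1 l2 l3 where "l1 * k1 + l2 * k2 + l3 * k3 = m" "l1 * x1 + l2 * x2 + l3 * x3 = s"
    "l1 * y1 + l2 * y2 + l3 * y3 = t"
proof -
  define d where "d = det3 (k1, x1, y1) (k2, x2, y2) (k3, x3, y3)"
  have d: "d \<noteq> 0" using assms by (simp add: d_def)
  define d1 where "d1 = det3 (m, s, t) (k2, x2, y2) (k3, x3, y3)"
  define d2 where "d2 = det3 (k1, x1, y1) (m, s, t) (k3, x3, y3)"
  define d3 where "d3 = det3 (k1, x1, y1) (k2, x2, y2) (m, s, t)"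
  have "d1 * k1 + d2 * k2 + d3 * k3 = d * m" "d1 * x1 + d2 * x2 + d3 * x3 = d * s"
    "d1 * y1 + d2 * y2 + d3 * y3 = d * t"
    by (simp_all add: d_def d1_def d2_def d3_def algebra_simps)
  then have "(d1 * k1 + d2 * k2 + d3 * k3) / d = m" "(d1 * x1 + d2 * x2 + d3 * x3) / d = s"
    "(d1 * y1 + d2 * y2 + d3 * y3) / d = t" using d by simp_all
  then show thesis
    by (intro that[of "d1 / d" "d2 / d" "d3 / d"]) (simp_all add: add_divide_distrib)
qed

section \<open>The powers of a generator of a real cubic field\<close>

lemma real_field_simps:
  "carrier real_field = UNIV" "\<one>\<^bsub>real_field\<^esub> = 1" "\<zero>\<^bsub>real_field\<^esub> = 0"
  "x \<otimes>\<^bsub>real_field\<^esub> y = x * y" "x \<oplus>\<^bsub>real_field\<^esub> y = x + y"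
  by (simp_all add: ring_of_type_algebra_def)

lemma real_field_minus: "\<ominus>\<^bsub>real_field\<^esub> x = - x"
proof -
  interpret F: field real_field by (rule field_from_type_algebra)
  show ?thesis by (rule F.minus_equality) (simp_all add: real_field_simps)
qed

lemma real_field_inv: "x \<noteq> 0 \<Longrightarrow> inv\<^bsub>real_field\<^esub> x = inverse x"
proof -
  interpret F: field real_field by (rule field_from_type_algebra)
  show "x \<noteq> 0 \<Longrightarrow> inv\<^bsub>real_field\<^esub> x = inverse x"
    by (intro F.comm_inv_char) (simp_all add: real_field_simps)
qed

text \<open>If \<open>\<theta>\<close> has degree at most two, then the span of \<open>1\<close> and \<open>\<theta>\<close> over the
  rationals is closed under all field operations. For inverses, multiply by the conjugate
  \<open>r + s u - s \<theta>\<close>: the product with \<open>r + s \<theta>\<close> is the rational norm \<open>n\<close>.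
  The degenerate case of rational \<open>\<theta>\<close> is included, and there the norm of a nonzero
  element may vanish.\<close>
lemma rat_adjoin_quadratic:
  assumes u: "u \<in> \<rat>" and w: "w \<in> \<rat>" and sq: "\<theta>\<^sup>2 = u * \<theta> + w"
  shows "rat_adjoin \<theta> \<subseteq> {r + s * \<theta> | r s. r \<in> \<rat> \<and> s \<in> \<rat>}" (is "_ \<subseteq> ?S")
proof
  fix h assume "h \<in> rat_adjoin \<theta>"
  then show "h \<in> ?S" unfolding rat_adjoin_def
  proof (induction rule: generate_field.induct)
    case one
    have "(1::real) = 1 + 0 * \<theta> \<and> (1::real) \<in> \<rat> \<and> (0::real) \<in> \<rat>" by simp
    then show ?case unfolding real_field_simps by blast
  next
    case (incl h)
    then show ?case
    proof
      assume "h \<in> \<rat>"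
      then have "h = h + 0 * \<theta> \<and> h \<in> \<rat> \<and> (0::real) \<in> \<rat>" by simp
      then show ?thesis by blast
    next
      assume "h \<in> {\<theta>}"
      then have "h = 0 + 1 * \<theta> \<and> (0::real) \<in> \<rat> \<and> (1::real) \<in> \<rat>" by simp
      then show ?thesis by blast
    qed
  next
    case (a_inv h)
    then obtain r s where "h = r + s * \<theta>" "r \<in> \<rat>" "s \<in> \<rat>" by blast
    then have "- h = (- r) + (- s) * \<theta> \<and> - r \<in> \<rat> \<and> - s \<in> \<rat>" by simp
    then show ?case unfolding real_field_minus by blast
  next
    case (m_inv h)
    then obtain r s where h: "h = r + s * \<theta>" "r \<in> \<rat>" "s \<in> \<rat>" by blast
    have h0: "h \<noteq> 0" using m_inv by (simp add: real_field_simps)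
    \<comment> \<open>The norm of \<open>h\<close>; the conjugate of \<open>\<theta>\<close> is \<open>u - \<theta>\<close>.\<close>
    define n where "n = r\<^sup>2 + r * s * u - s\<^sup>2 * w"
    have n: "n \<in> \<rat>" unfolding n_def using u w h by simp
    have prod: "h * (r + s * u - s * \<theta>) = n"
    proof -
      have "h * (r + s * u - s * \<theta>) = r\<^sup>2 + r * s * u + s\<^sup>2 * (u * \<theta> - \<theta>\<^sup>2)"
        unfolding h(1) by (simp add: algebra_simps power2_eq_square)
      then show ?thesis unfolding n_def sq by simp
    qed
    show ?case
    proof (cases "n = 0")
      case False
      then have "inverse h = (r + s * u - s * \<theta>) / n"
        unfolding prod[symmetric] by (simp add: inverse_eq_divide)
      also have "\<dots> = (r + s * u) / n + (- s / n) * \<theta>" by (simp add: diff_divide_distrib)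
      finally have "inverse h = (r + s * u) / n + (- s / n) * \<theta> \<and> (r + s * u) / n \<in> \<rat> \<and> - s / n \<in> \<rat>"
        using h n u by simp
      then show ?thesis unfolding real_field_inv[OF h0] by blast
    next
      case True
      have "h \<in> \<rat>"
      proof (cases "s = 0")
        case True
        with h show ?thesis by simp
      next
        case False
        have "s * \<theta> = r + s * u" using prod h0 True by simp
        then show ?thesis using h u by simp
      qed
      then have "inverse h = inverse h + 0 * \<theta> \<and> inverse h \<in> \<rat> \<and> (0::real) \<in> \<rat>" by simp
      then show ?thesis unfolding real_field_inv[OF h0] by blast
    qed
  next
    case (eng_add h1 h2)
    then obtain r s r' s' where "h1 = r + s * \<theta>" "r \<in> \<rat>" "s \<in> \<rat>"
      "h2 = r' + s' * \<theta>" "r' \<in> \<rat>" "s' \<in> \<rat>" by blast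
    then have "h1 + h2 = (r + r') + (s + s') * \<theta> \<and> r + r' \<in> \<rat> \<and> s + s' \<in> \<rat>"
      by (simp add: algebra_simps)
    then show ?case unfolding real_field_simps by blast
  next
    case (eng_mult h1 h2)
    then obtain r s r' s' where h: "h1 = r + s * \<theta>" "r \<in> \<rat>" "s \<in> \<rat>"
      "h2 = r' + s' * \<theta>" "r' \<in> \<rat>" "s' \<in> \<rat>" by blast
    have "h1 * h2 = (r * r' + s * s' * w) + (r * s' + r' * s + s * s' * u) * \<theta>"
    proof -
      have "h1 * h2 = r * r' + (r * s' + r' * s) * \<theta> + s * s' * \<theta>\<^sup>2"
        unfolding h(1,4) by (simp add: algebra_simps power2_eq_square)
      then show ?thesis unfolding sq by (simp add: algebra_simps)
    qed
    with h u w have "h1 * h2 = (r * r' + s * s' * w) + (r * s' + r' * s + s * s' * u) * \<theta> \<and>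
      r * r' + s * s' * w \<in> \<rat> \<and> r * s' + r' * s + s * s' * u \<in> \<rat>" by simp
    then show ?case unfolding real_field_simps by blast
  qed
qed

text \<open>A nontrivial relation makes \<open>\<theta>\<close> quadratic or rational, so that the field would be spanned
  by at most two elements, contrary to its dimension three.\<close>
lemma cubic_number_field_independent:
  fixes r s t :: int
  assumes cubic: "cubic_number_field (rat_adjoin \<theta>)"
    and rel: "of_int r + of_int s * \<theta> + of_int t * \<theta>\<^sup>2 = 0"
  shows "r = 0 \<and> s = 0 \<and> t = 0"
proof (rule ccontr)
  interpret F: field real_field by (rule field_from_type_algebra)
  assume "\<not> (r = 0 \<and> s = 0 \<and> t = 0)"
  then have nz: "r \<noteq> 0 \<or> s \<noteq> 0 \<or> t \<noteq> 0" by blast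
  have "\<exists>u w. u \<in> \<rat> \<and> w \<in> \<rat> \<and> \<theta>\<^sup>2 = u * \<theta> + w"
  proof (cases "t = 0")
    case True
    with rel nz have "s \<noteq> 0" by auto
    with True rel have "\<theta> = - of_int r / of_int s" by (simp add: field_simps)
    then have "\<theta> \<in> \<rat> \<and> (0::real) \<in> \<rat> \<and> \<theta>\<^sup>2 = \<theta> * \<theta> + 0"
      by (simp add: power2_eq_square)
    then show ?thesis by blast
  next
    case False
    with rel have "\<theta>\<^sup>2 = (- of_int s / of_int t) * \<theta> + (- of_int r / of_int t)"
      by (simp add: field_simps)
    moreover have "- of_int s / of_int t \<in> (\<rat>::real set)" "- of_int r / of_int t \<in> (\<rat>::real set)"
      by simp_all
    ultimately show ?thesis by blast
  qed
  then obtain u w where uw: "u \<in> \<rat>" "w \<in> \<rat>" "\<theta>\<^sup>2 = u * \<theta> + w" by blast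
  have Span1: "x \<in> F.Span \<rat> [y] \<longleftrightarrow> (\<exists>r\<in>\<rat>. x = r * y)" for x y
    by (auto simp: F.line_extension_mem_iff real_field_simps)
  have indep1: "F.independent \<rat> [y]" if "y \<noteq> 0" for y
    using that by (intro F.li_Cons F.li_Nil) (simp_all add: real_field_simps)
  have "\<exists>Us. F.independent \<rat> Us \<and> length Us \<le> 2 \<and> rat_adjoin \<theta> \<subseteq> F.Span \<rat> Us"
  proof (cases "\<theta> \<in> \<rat>")
    case True
    have "rat_adjoin \<theta> \<subseteq> F.Span \<rat> [1]"
    proof
      fix h assume "h \<in> rat_adjoin \<theta>"
      then have "h \<in> \<rat>" using rat_adjoin_quadratic[OF uw] True by auto
      then show "h \<in> F.Span \<rat> [1]" unfolding Span1 by simp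
    qed
    then show ?thesis using indep1[of 1] by (intro exI[of _ "[1]"]) simp
  next
    case False
    then have "\<theta> \<noteq> 0" by auto
    have "1 \<notin> F.Span \<rat> [\<theta>]"
    proof
      assume "1 \<in> F.Span \<rat> [\<theta>]"
      then obtain r where "r \<in> \<rat>" "1 = r * \<theta>" unfolding Span1 by blast
      with \<open>\<theta> \<noteq> 0\<close> have "\<theta> = 1 / r" by (metis mult_zero_left nonzero_mult_div_cancel_left zero_neq_one)
      with \<open>r \<in> \<rat>\<close> False show False by simp
    qed
    then have "F.independent \<rat> [1, \<theta>]"
      using \<open>\<theta> \<noteq> 0\<close> \<open>1 \<notin> _\<close>
      by (intro F.li_Cons[OF _ _ indep1]) (simp_all add: real_field_simps del: F.Span.simps)
    moreover have "rat_adjoin \<theta> \<subseteq> F.Span \<rat> [1, \<theta>]"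
    proof
      fix h assume "h \<in> rat_adjoin \<theta>"
      then obtain r s where "h = r + s * \<theta>" "r \<in> \<rat>" "s \<in> \<rat>"
        using rat_adjoin_quadratic[OF uw] by blast
      then have "set [r, s] \<subseteq> \<rat> \<and> length [r, s] = length [1, \<theta>] \<and> h = F.combine [r, s] [1, \<theta>]"
        by (simp add: real_field_simps)
      moreover have "set [1, \<theta>] \<subseteq> carrier real_field" by (simp add: real_field_simps)
      ultimately show "h \<in> F.Span \<rat> [1, \<theta>]"
        using F.Span_mem_iff_length_version[OF subfield_Rats] by blast
    qed
    ultimately show ?thesis by (intro exI[of _ "[1, \<theta>]"]) simp
  qed
  then obtain Us where Us: "F.independent \<rat> Us" "length Us \<le> 2" "rat_adjoin \<theta> \<subseteq> F.Span \<rat> Us"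
    by blast
  obtain Vs where Vs: "F.independent \<rat> Vs" "length Vs = 3" "F.Span \<rat> Vs = rat_adjoin \<theta>"
    using F.exists_base[OF subfield_Rats, of 3 "rat_adjoin \<theta>"] cubic
    unfolding cubic_number_field_def by blast
  have "set Vs \<subseteq> F.Span \<rat> Vs"
    using F.Span_base_incl[OF subfield_Rats] by (auto simp: real_field_simps)
  then have "length Vs \<le> length Us"
    using Us Vs by (intro F.independent_length_le[OF subfield_Rats]) auto
  with \<open>length Vs = 3\<close> Us(2) show False by simp
qed

text \<open>The four powers \<open>1, \<theta>, \<theta>\<^sup>2, \<theta>\<^sup>3\<close> are dependent in a space of dimension three.
  Clearing denominators leaves a leading coefficient \<open>D\<close>, which is nonzero since the lower powers
  are independent.\<close>
lemma cubic_number_field_relation: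
  assumes "cubic_number_field (rat_adjoin \<theta>)"
  obtains D e0 e1 e2 :: int where "D \<noteq> 0"
    "of_int D * \<theta> ^ 3 = of_int e0 + of_int e1 * \<theta> + of_int e2 * \<theta>\<^sup>2"
proof -
  interpret F: field real_field by (rule field_from_type_algebra)
  let ?K = "rat_adjoin \<theta>" and ?Us = "[\<theta> ^ 3, \<theta>\<^sup>2, \<theta>, 1]"
  have ind: "of_int r + of_int s * \<theta> + of_int t * \<theta>\<^sup>2 = 0 \<Longrightarrow> r = 0 \<and> s = 0 \<and> t = 0" for r s t
    using cubic_number_field_independent[OF assms] by blast
  have one: "1 \<in> ?K" and th: "\<theta> \<in> ?K"
    using generate_field.one[of real_field] generate_field.incl[of \<theta> "\<rat> \<union> {\<theta>}" real_field]
    by (auto simp: rat_adjoin_def real_field_simps)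
  have mult: "x * y \<in> ?K" if "x \<in> ?K" "y \<in> ?K" for x y
    using generate_field.eng_mult[of x real_field _ y] that
    by (simp add: rat_adjoin_def real_field_simps)
  have "\<theta>\<^sup>2 \<in> ?K" "\<theta> ^ 3 \<in> ?K"
    using th by (auto simp: power2_eq_square power3_eq_cube intro!: mult)
  then have "set ?Us \<subseteq> ?K" using one th by simp
  then have dep: "\<not> F.independent \<rat> ?Us"
    using F.independent_length_le_dimension[OF subfield_Rats, of 3 ?K ?Us] assms
    unfolding cubic_number_field_def by auto
  obtain Ks where Ks: "length Ks = length ?Us" "F.combine Ks ?Us = 0" "set Ks \<subseteq> \<rat>" "set Ks \<noteq> {0}"
    using F.dependent_imp_non_trivial_combine[OF subfield_Rats _ dep] unfolding real_field_simps by auto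
  from Ks(1) obtain c3 c2 c1 c0 where Ks_eq: "Ks = [c3, c2, c1, c0]"
    by (auto simp: length_Suc_conv)
  have rel: "c3 * \<theta> ^ 3 + c2 * \<theta>\<^sup>2 + c1 * \<theta> + c0 = 0" and nz: "c3 \<noteq> 0 \<or> c2 \<noteq> 0 \<or> c1 \<noteq> 0 \<or> c0 \<noteq> 0"
    using Ks(2,4) by (auto simp: Ks_eq real_field_simps add.assoc)
  have rats: "c0 \<in> \<rat>" "c1 \<in> \<rat>" "c2 \<in> \<rat>" "c3 \<in> \<rat>" using Ks(3) by (auto simp: Ks_eq)
  obtain p0 q0 where c0: "q0 > 0" "c0 = of_int p0 / of_int q0" using rats(1) by (rule Rats_cases')
  obtain p1 q1 where c1: "q1 > 0" "c1 = of_int p1 / of_int q1" using rats(2) by (rule Rats_cases')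
  obtain p2 q2 where c2: "q2 > 0" "c2 = of_int p2 / of_int q2" using rats(3) by (rule Rats_cases')
  obtain p3 q3 where c3: "q3 > 0" "c3 = of_int p3 / of_int q3" using rats(4) by (rule Rats_cases')
  note q = c0(1) c1(1) c2(1) c3(1) and c = c0(2) c1(2) c2(2) c3(2)
  define Q where "Q = q0 * q1 * q2 * q3"
  have Q: "Q \<noteq> 0" using q by (simp add: Q_def)
  define g0 g1 g2 g3 where "g0 = p0 * q1 * q2 * q3" and "g1 = q0 * p1 * q2 * q3"
    and "g2 = q0 * q1 * p2 * q3" and "g3 = q0 * q1 * q2 * p3"
  have g: "of_int Q * c0 = of_int g0" "of_int Q * c1 = of_int g1"
    "of_int Q * c2 = of_int g2" "of_int Q * c3 = of_int g3"
    using q by (simp_all add: c Q_def g0_def g1_def g2_def g3_def)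
  have "of_int g3 * \<theta> ^ 3 + of_int g2 * \<theta>\<^sup>2 + of_int g1 * \<theta> + of_int g0
      = of_int Q * (c3 * \<theta> ^ 3 + c2 * \<theta>\<^sup>2 + c1 * \<theta> + c0)"
    unfolding g[symmetric] by (simp only: distrib_left mult.assoc)
  then have rel': "of_int g3 * \<theta> ^ 3 + of_int g2 * \<theta>\<^sup>2 + of_int g1 * \<theta> + of_int g0 = 0"
    unfolding rel by simp
  have "g3 \<noteq> 0"
  proof
    assume "g3 = 0"
    moreover from this have "g0 = 0 \<and> g1 = 0 \<and> g2 = 0"
      using rel' ind[of g0 g1 g2] by (simp add: add.commute add.left_commute)
    ultimately have "of_int Q * c0 = 0" "of_int Q * c1 = 0" "of_int Q * c2 = 0" "of_int Q * c3 = 0"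
      unfolding g by simp_all
    with Q nz show False by simp
  qed
  moreover have "of_int g3 * \<theta> ^ 3 = of_int (- g0) + of_int (- g1) * \<theta> + of_int (- g2) * \<theta>\<^sup>2"
    using rel' by simp
  ultimately show thesis by (rule that)
qed

section \<open>Simultaneous approximation of a cubic irrational and its square\<close>

text \<open>The arithmetic information on \<open>\<theta>\<close> that the approximation theory uses. The
  coefficient \<open>D\<close> collects the denominators of the cubic relation and only affects
  constants.\<close>
locale cubic_irrational =
  fixes \<theta> :: real and D e0 e1 e2 :: int
  assumes independent: "\<And>r s t :: int. of_int r + of_int s * \<theta> + of_int t * \<theta>\<^sup>2 = 0 \<Longrightarrow> r = 0 \<and> s = 0 \<and> t = 0"
    and D_nonzero: "D \<noteq> 0"
    and cubic: "of_int D * \<theta> ^ 3 = of_int e0 + of_int e1 * \<theta> + of_int e2 * \<theta>\<^sup>2"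
begin

text \<open>Let \<open>M\<close> be the rational matrix of multiplication by \<open>\<theta>\<close> on the basis
  \<open>(1, \<theta>, \<theta>\<^sup>2)\<close>. Then \<open>companion\<close> applies the integer matrix \<open>D M\<close> to a
  column vector and \<open>cocompanion\<close> applies it to a row vector. The real column
  \<open>(1, \<theta>, \<theta>\<^sup>2)\<close> is an eigenvector of \<open>D M\<close> with eigenvalue \<open>D \<theta>\<close>.
  On rows, identified with field elements by \<open>lin_form\<close>, the map is multiplication by
  \<open>D \<theta>\<close>.\<close>
fun companion :: "int \<times> int \<times> int \<Rightarrow> int \<times> int \<times> int" where
  "companion (k, p, q) = (D * p, D * q, e0 * k + e1 * p + e2 * q)"

fun cocompanion :: "int \<times> int \<times> int \<Rightarrow> int \<times> int \<times> int" where
  "cocompanion (r, s, t) = (e0 * t, D * r + e1 * t, D * s + e2 * t)"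

fun lin_form :: "int \<times> int \<times> int \<Rightarrow> real" where
  "lin_form (r, s, t) = of_int r + of_int s * \<theta> + of_int t * \<theta>\<^sup>2"

fun approx :: "real \<Rightarrow> int \<times> int \<times> int \<Rightarrow> bool" where
  "approx \<epsilon> (k, p, q) \<longleftrightarrow>
     \<bar>of_int k * \<theta> - of_int p\<bar> \<le> \<epsilon> \<and> \<bar>of_int k * \<theta>\<^sup>2 - of_int q\<bar> \<le> \<epsilon>"

lemma lin_form_eq_0_iff: "lin_form u = 0 \<longleftrightarrow> u = (0, 0, 0)"
  using independent by (cases u) auto

lemma lin_form_cocompanion: "lin_form (cocompanion u) = of_int D * \<theta> * lin_form u"
proof (cases u)
  case (fields r s t)
  have "of_int D * \<theta> * lin_form u
    = of_int D * of_int r * \<theta> + of_int D * of_int s * \<theta>\<^sup>2 + of_int t * (of_int D * \<theta> ^ 3)"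
    by (simp add: fields algebra_simps power2_eq_square power3_eq_cube)
  also have "\<dots> = lin_form (cocompanion u)"
    unfolding cubic by (simp add: fields algebra_simps)
  finally show ?thesis ..
qed

lemma dot3_companion: "dot3 u (companion v) = dot3 (cocompanion u) v"
  by (cases u; cases v) (simp add: algebra_simps)

text \<open>Every nonzero integer vector is cyclic for the companion matrix, as its characteristic
  polynomial is irreducible. Concretely, if the three vectors were dependent, some integer row
  \<open>u \<noteq> 0\<close> would annihilate all of them; equivalently, \<open>v\<close> would be annihilated by
  \<open>u\<close> and its images under \<open>cocompanion\<close>. These three rows would then be dependent.
  But they represent \<open>\<kappa>\<close>, \<open>D \<theta> \<kappa>\<close> and \<open>D\<^sup>2 \<theta>\<^sup>2 \<kappa>\<close>
  for a nonzero field element \<open>\<kappa>\<close>, so \<open>1\<close>, \<open>\<theta>\<close>, \<open>\<theta>\<^sup>2\<close> would be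
  dependent. Up to a constant factor, the determinant is a norm of a field element depending linearly
  on \<open>v\<close>.\<close>
lemma det3_companion_nonzero:
  assumes "v \<noteq> (0, 0, 0)"
  shows "det3 v (companion v) (companion (companion v)) \<noteq> 0"
proof
  assume "det3 v (companion v) (companion (companion v)) = 0"
  then obtain u where u: "u \<noteq> (0, 0, 0)" "dot3 v u = 0" "dot3 (companion v) u = 0"
    "dot3 (companion (companion v)) u = 0"
    by (rule det3_zero_imp_kernel)
  have orth: "dot3 u v = 0" "dot3 (cocompanion u) v = 0" "dot3 (cocompanion (cocompanion u)) v = 0"
    using u(2-4) unfolding dot3_commute[of _ u] dot3_companion by simp_all
  obtain u1 u2 u3 where u_eq: "u = (u1, u2, u3)" by (rule prod_cases3)
  obtain s1 s2 s3 where s_eq: "cocompanion u = (s1, s2, s3)" by (rule prod_cases3)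
  obtain t1 t2 t3 where t_eq: "cocompanion (cocompanion u) = (t1, t2, t3)" by (rule prod_cases3)
  have "det3 u (cocompanion u) (cocompanion (cocompanion u)) = 0"
    by (rule kernel_imp_det3_zero[OF orth assms])
  \<comment> \<open>The kernel of the transposed matrix is a relation between the three rows.\<close>
  then have "det3 (u1, s1, t1) (u2, s2, t2) (u3, s3, t3) = 0"
    unfolding t_eq unfolding s_eq unfolding u_eq by (rule trans[OF det3_transpose[symmetric]])
  then obtain x where x0: "x \<noteq> (0, 0, 0)" and x: "dot3 (u1, s1, t1) x = 0" "dot3 (u2, s2, t2) x = 0"
    "dot3 (u3, s3, t3) x = 0"
    by (rule det3_zero_imp_kernel)
  obtain x1 x2 x3 where x_eq: "x = (x1, x2, x3)" by (rule prod_cases3)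
  have "of_int x1 * lin_form u + of_int x2 * lin_form (cocompanion u) + of_int x3 * lin_form (cocompanion (cocompanion u))
      = of_int (u1 * x1 + s1 * x2 + t1 * x3) + of_int (u2 * x1 + s2 * x2 + t2 * x3) * \<theta>
        + of_int (u3 * x1 + s3 * x2 + t3 * x3) * \<theta>\<^sup>2"
    unfolding t_eq unfolding s_eq unfolding u_eq by (simp add: algebra_simps)
  also have "\<dots> = 0" using x by (simp add: x_eq)
  finally have "lin_form u * lin_form (x1, D * x2, D\<^sup>2 * x3) = 0"
    unfolding lin_form_cocompanion by (simp add: algebra_simps power2_eq_square)
  with u(1) have "(x1, D * x2, D\<^sup>2 * x3) = (0, 0, 0)"
    by (metis lin_form_eq_0_iff mult_eq_0_iff)
  then have "x = (0, 0, 0)" using D_nonzero x_eq by simp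
  with x0 show False by contradiction
qed

text \<open>An integer vector close to the eigenline of \<open>(1, \<theta>, \<theta>\<^sup>2)\<close> is mapped to one close to
  the same line: the new errors are fixed linear combinations of the old ones, and the large
  component along the line does not contribute to them.\<close>
lemma companion_step:
  "\<exists>B\<ge>1. \<forall>k p q k' p' q' \<epsilon>. companion (k, p, q) = (k', p', q') \<longrightarrow> approx \<epsilon> (k, p, q) \<longrightarrow>
     \<bar>real_of_int k'\<bar> \<le> B * (\<bar>real_of_int k\<bar> + \<epsilon>) \<and> approx (B * \<epsilon>) (k', p', q')"
proof -
  define B where "B = \<bar>of_int D\<bar> * (1 + \<bar>\<theta>\<bar>) + \<bar>of_int e1 - of_int D * \<theta>\<^sup>2\<bar> + \<bar>real_of_int e2\<bar>"
  have B1: "\<bar>of_int D\<bar> * (1 + \<bar>\<theta>\<bar>) \<le> B" unfolding B_def by simp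
  have D1: "1 \<le> \<bar>real_of_int D\<bar>" using D_nonzero by linarith
  also have "\<bar>real_of_int D\<bar> \<le> \<bar>of_int D\<bar> * (1 + \<bar>\<theta>\<bar>)" by (simp add: algebra_simps)
  finally have B2: "1 \<le> B" using B1 by linarith
  show ?thesis unfolding approx.simps
  proof (rule exI[of _ B], intro conjI allI impI)
    show "1 \<le> B" by (rule B2)
    fix k p q k' p' q' \<epsilon>
    assume c: "companion (k, p, q) = (k', p', q')"
      and "\<bar>of_int k * \<theta> - of_int p\<bar> \<le> \<epsilon> \<and> \<bar>of_int k * \<theta>\<^sup>2 - of_int q\<bar> \<le> \<epsilon>"
    then have x: "\<bar>of_int k * \<theta> - of_int p\<bar> \<le> \<epsilon>" and y: "\<bar>of_int k * \<theta>\<^sup>2 - of_int q\<bar> \<le> \<epsilon>"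
      by blast+
    define \<xi> \<eta> where "\<xi> = of_int k * \<theta> - of_int p" and "\<eta> = of_int k * \<theta>\<^sup>2 - of_int q"
    have small: "\<bar>\<xi>\<bar> \<le> \<epsilon>" "\<bar>\<eta>\<bar> \<le> \<epsilon>" using x y by (simp_all add: \<xi>_def \<eta>_def)
    have eqs: "k' = D * p" "p' = D * q" "q' = e0 * k + e1 * p + e2 * q" using c by auto
    have "\<epsilon> \<ge> 0" using x by linarith
    have tri: "\<bar>s * \<xi> + t * \<eta>\<bar> \<le> (\<bar>s\<bar> + \<bar>t\<bar>) * \<epsilon>" for s t
    proof -
      have "\<bar>s * \<xi>\<bar> \<le> \<bar>s\<bar> * \<epsilon>" "\<bar>t * \<eta>\<bar> \<le> \<bar>t\<bar> * \<epsilon>"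
        unfolding abs_mult using small by (auto intro: mult_left_mono)
      then show ?thesis by (simp add: algebra_simps)
    qed
    have "of_int k' = of_int D * (of_int k * \<theta> - \<xi>)" by (simp add: eqs \<xi>_def)
    then have "\<bar>of_int k'\<bar> = \<bar>of_int D\<bar> * \<bar>of_int k * \<theta> - \<xi>\<bar>" by (simp add: abs_mult)
    also have "\<dots> \<le> \<bar>of_int D\<bar> * (\<bar>of_int k\<bar> * \<bar>\<theta>\<bar> + \<epsilon>)"
      using small abs_triangle_ineq4[of "of_int k * \<theta>" \<xi>] by (intro mult_left_mono) (auto simp: abs_mult)
    also have "\<dots> \<le> \<bar>of_int D\<bar> * ((1 + \<bar>\<theta>\<bar>) * (\<bar>of_int k\<bar> + \<epsilon>))"
      using \<open>\<epsilon> \<ge> 0\<close> by (intro mult_left_mono) (auto simp: algebra_simps)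
    also have "\<dots> = \<bar>of_int D\<bar> * (1 + \<bar>\<theta>\<bar>) * (\<bar>of_int k\<bar> + \<epsilon>)" by simp
    also have "\<dots> \<le> B * (\<bar>of_int k\<bar> + \<epsilon>)"
      using B1 \<open>\<epsilon> \<ge> 0\<close> by (intro mult_right_mono) auto
    finally show "\<bar>of_int k'\<bar> \<le> B * (\<bar>of_int k\<bar> + \<epsilon>)" .
    have "of_int k' * \<theta> - of_int p' = (- of_int D * \<theta>) * \<xi> + of_int D * \<eta>"
      by (simp add: eqs \<xi>_def \<eta>_def algebra_simps power2_eq_square)
    also have "\<bar>\<dots>\<bar> \<le> (\<bar>- of_int D * \<theta>\<bar> + \<bar>of_int D\<bar>) * \<epsilon>" by (rule tri)
    also have "\<dots> \<le> B * \<epsilon>"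
      using B1 \<open>\<epsilon> \<ge> 0\<close> by (intro mult_right_mono) (auto simp: abs_mult algebra_simps)
    finally show "\<bar>of_int k' * \<theta> - of_int p'\<bar> \<le> B * \<epsilon>" .
    have "of_int k' * \<theta>\<^sup>2 - of_int q' = (of_int e1 - of_int D * \<theta>\<^sup>2) * \<xi> + of_int e2 * \<eta>
        + of_int k * (of_int D * \<theta> ^ 3 - (of_int e0 + of_int e1 * \<theta> + of_int e2 * \<theta>\<^sup>2))"
      by (simp add: eqs \<xi>_def \<eta>_def algebra_simps power2_eq_square power3_eq_cube)
    also have "\<dots> = (of_int e1 - of_int D * \<theta>\<^sup>2) * \<xi> + of_int e2 * \<eta>" using cubic by simp
    also have "\<bar>\<dots>\<bar> \<le> (\<bar>of_int e1 - of_int D * \<theta>\<^sup>2\<bar> + \<bar>of_int e2\<bar>) * \<epsilon>" by (rule tri)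
    also have "\<dots> \<le> B * \<epsilon>"
      using \<open>\<epsilon> \<ge> 0\<close> unfolding B_def by (intro mult_right_mono) auto
    finally show "\<bar>of_int k' * \<theta>\<^sup>2 - of_int q'\<bar> \<le> B * \<epsilon>" .
  qed
qed


text \<open>One good simultaneous approximation yields three linearly independent ones of comparable
  quality. Both halves of the main result rest on this.\<close>
lemma independent_approximations:
  obtains B where "B \<ge> 1"
    "\<And>k p q \<epsilon>. (k, p, q) \<noteq> (0, 0, 0) \<Longrightarrow> approx \<epsilon> (k, p, q) \<Longrightarrow>
       \<exists>k1 p1 q1 k2 p2 q2. det3 (k, p, q) (k1, p1, q1) (k2, p2, q2) \<noteq> 0 \<and>
         \<bar>real_of_int k1\<bar> \<le> B * (\<bar>of_int k\<bar> + \<epsilon>) \<and> \<bar>real_of_int k2\<bar> \<le> B * (\<bar>of_int k\<bar> + \<epsilon>) \<and>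
         approx (B * \<epsilon>) (k1, p1, q1) \<and> approx (B * \<epsilon>) (k2, p2, q2)"
proof -
  obtain B where B: "B \<ge> 1"
    "\<And>k p q k' p' q' \<epsilon>. companion (k, p, q) = (k', p', q') \<Longrightarrow> approx \<epsilon> (k, p, q) \<Longrightarrow>
     \<bar>real_of_int k'\<bar> \<le> B * (\<bar>real_of_int k\<bar> + \<epsilon>) \<and> approx (B * \<epsilon>) (k', p', q')"
    using companion_step by blast
  have le: "B * z \<le> 2 * B\<^sup>2 * z" if "z \<ge> 0" for z
  proof -
    have "B * z \<le> B * (B * z)" "0 \<le> B * (B * z)"
      using mult_right_mono[OF B(1), of "B * z"] B(1) that by simp_all
    then show ?thesis by (simp add: power2_eq_square mult.assoc)
  qed
  \<comment> \<open>Applying the companion map twice costs \<open>B\<^sup>2\<close>; the factor 2 absorbs the error term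
    in the bound for the denominator of the second image.\<close>
  have "\<exists>k1 p1 q1 k2 p2 q2. det3 (k, p, q) (k1, p1, q1) (k2, p2, q2) \<noteq> 0 \<and>
         \<bar>real_of_int k1\<bar> \<le> 2 * B\<^sup>2 * (\<bar>of_int k\<bar> + \<epsilon>) \<and> \<bar>real_of_int k2\<bar> \<le> 2 * B\<^sup>2 * (\<bar>of_int k\<bar> + \<epsilon>) \<and>
         approx (2 * B\<^sup>2 * \<epsilon>) (k1, p1, q1) \<and> approx (2 * B\<^sup>2 * \<epsilon>) (k2, p2, q2)"
    if nz: "(k, p, q) \<noteq> (0, 0, 0)" and a: "approx \<epsilon> (k, p, q)" for k p q \<epsilon>
  proof -
    obtain k1 p1 q1 where v1: "companion (k, p, q) = (k1, p1, q1)" by (rule prod_cases3)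
    obtain k2 p2 q2 where v2: "companion (k1, p1, q1) = (k2, p2, q2)" by (rule prod_cases3)
    have e: "\<epsilon> \<ge> 0" using a by auto
    note 1 = B(2)[OF v1 a] and 2 = B(2)[OF v2 conjunct2[OF B(2)[OF v1 a]]]
    have mono: "approx \<delta> v \<Longrightarrow> \<delta> \<le> \<delta>' \<Longrightarrow> approx \<delta>' v" for \<delta> \<delta>' v
      by (cases v) auto
    have "det3 (k, p, q) (k1, p1, q1) (k2, p2, q2) \<noteq> 0"
      using det3_companion_nonzero[OF nz] unfolding v1 v2 .
    moreover have "\<bar>real_of_int k1\<bar> \<le> 2 * B\<^sup>2 * (\<bar>of_int k\<bar> + \<epsilon>)"
      using 1 le[of "\<bar>of_int k\<bar> + \<epsilon>"] e by linarith
    moreover have "\<bar>real_of_int k2\<bar> \<le> 2 * B\<^sup>2 * (\<bar>of_int k\<bar> + \<epsilon>)"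
    proof -
      have "\<bar>real_of_int k2\<bar> \<le> B * (\<bar>of_int k1\<bar> + B * \<epsilon>)" using 2 by blast
      also have "\<dots> \<le> B * (B * (\<bar>of_int k\<bar> + \<epsilon>) + B * (\<bar>of_int k\<bar> + \<epsilon>))"
        using 1 B(1) by (intro mult_left_mono add_mono) auto
      finally show ?thesis by (simp add: power2_eq_square)
    qed
    moreover have "approx (2 * B\<^sup>2 * \<epsilon>) (k1, p1, q1)"
      using 1 le[OF e] mono by blast
    moreover have "approx (2 * B\<^sup>2 * \<epsilon>) (k2, p2, q2)"
    proof (rule mono[OF conjunct2[OF 2]])
      show "B * (B * \<epsilon>) \<le> 2 * B\<^sup>2 * \<epsilon>" using e B(1) by (simp add: power2_eq_square mult.assoc)
    qed
    ultimately show ?thesis by blast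
  qed
  moreover have "1 \<le> 2 * B\<^sup>2" using one_le_power[OF B(1), of 2] by linarith
  ultimately show thesis using that by blast
qed

text \<open>The determinant of three independent integer vectors is at least \<open>1\<close> in absolute value,
  while in terms of denominators of size \<open>k\<close> and errors of size \<open>\<epsilon>\<close> it is
  \<open>O(k \<epsilon>\<^sup>2)\<close>.\<close>
lemma badly_approximable:
  obtains c where "c > 0"
    "\<And>k p q \<epsilon>. k \<noteq> 0 \<Longrightarrow> approx \<epsilon> (k, p, q) \<Longrightarrow> c / sqrt \<bar>of_int k\<bar> \<le> \<epsilon>"
proof -
  obtain B where B: "B \<ge> 1"
    and ind: "\<And>k p q \<epsilon>. (k, p, q) \<noteq> (0, 0, 0) \<Longrightarrow> approx \<epsilon> (k, p, q) \<Longrightarrow>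
       \<exists>k1 p1 q1 k2 p2 q2. det3 (k, p, q) (k1, p1, q1) (k2, p2, q2) \<noteq> 0 \<and>
         \<bar>real_of_int k1\<bar> \<le> B * (\<bar>of_int k\<bar> + \<epsilon>) \<and> \<bar>real_of_int k2\<bar> \<le> B * (\<bar>of_int k\<bar> + \<epsilon>) \<and>
         approx (B * \<epsilon>) (k1, p1, q1) \<and> approx (B * \<epsilon>) (k2, p2, q2)"
    using independent_approximations by metis
  define c where "c = 1 / sqrt (12 * B ^ 3)"
  have B3: "12 * B ^ 3 \<ge> 1" using one_le_power[OF B, of 3] by linarith
  have c: "c > 0" "c \<le> 1" using B3 B by (auto simp: c_def)
  show thesis
  proof (rule that[OF c(1)])
    fix k p q \<epsilon> assume k: "k \<noteq> 0" and a: "approx \<epsilon> (k, p, q)"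
    have k1: "1 \<le> \<bar>real_of_int k\<bar>" using k by linarith
    have e: "\<epsilon> \<ge> 0" using a by auto
    show "c / sqrt \<bar>of_int k\<bar> \<le> \<epsilon>"
    proof (cases "\<epsilon> \<le> 1")
      case False
      have "c / sqrt \<bar>of_int k\<bar> \<le> 1 / 1" using c k1 by (intro frac_le) auto
      with False show ?thesis by linarith
    next
      case True
      have "(k, p, q) \<noteq> (0, 0, 0)" using k by simp
      from ind[OF this a] obtain k1 p1 q1 k2 p2 q2 where d: "det3 (k, p, q) (k1, p1, q1) (k2, p2, q2) \<noteq> 0"
         and bd: "\<bar>real_of_int k1\<bar> \<le> B * (\<bar>of_int k\<bar> + \<epsilon>)" "\<bar>real_of_int k2\<bar> \<le> B * (\<bar>of_int k\<bar> + \<epsilon>)"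
         "approx (B * \<epsilon>) (k1, p1, q1)" "approx (B * \<epsilon>) (k2, p2, q2)" by blast
      have Be: "\<epsilon> \<le> B * \<epsilon>" using mult_right_mono[OF B e] by simp
      have Bk: "\<bar>of_int k\<bar> \<le> B * (\<bar>of_int k\<bar> + \<epsilon>)"
        using mult_right_mono[OF B, of "\<bar>of_int k\<bar> + \<epsilon>"] e by simp
      have "1 \<le> \<bar>real_of_int (det3 (k, p, q) (k1, p1, q1) (k2, p2, q2))\<bar>"
        using d by linarith
      also have "real_of_int (det3 (k, p, q) (k1, p1, q1) (k2, p2, q2))
          = det3 (real_of_int k, real_of_int p, real_of_int q)
             (real_of_int k1, real_of_int p1, real_of_int q1) (real_of_int k2, real_of_int p2, real_of_int q2)"
        by simp
      also have "\<bar>\<dots>\<bar> \<le> 6 * (B * (\<bar>of_int k\<bar> + \<epsilon>)) * (B * \<epsilon>)\<^sup>2"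
        using bd a Be Bk
        by (subst det3_shear[where x = \<theta> and y = "\<theta>\<^sup>2"], intro det3_bound) auto
      also have "\<dots> \<le> 6 * (B * (2 * \<bar>of_int k\<bar>)) * (B * \<epsilon>)\<^sup>2"
        using True k1 B by (intro mult_left_mono mult_right_mono) auto
      also have "\<dots> = 12 * B ^ 3 * (\<bar>of_int k\<bar> * \<epsilon>\<^sup>2)"
        by (simp add: power2_eq_square power3_eq_cube)
      finally have "sqrt 1 \<le> sqrt (12 * B ^ 3 * (\<bar>of_int k\<bar> * \<epsilon>\<^sup>2))" by (rule real_sqrt_le_mono)
      also have "\<dots> = sqrt (12 * B ^ 3) * (sqrt \<bar>of_int k\<bar> * \<epsilon>)"
        using e by (simp only: real_sqrt_mult real_sqrt_abs abs_of_nonneg)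
      finally have "1 \<le> sqrt (12 * B ^ 3) * (sqrt \<bar>of_int k\<bar> * \<epsilon>)" by simp
      moreover have "sqrt (12 * B ^ 3) > 0" "sqrt \<bar>of_int k\<bar> > 0" using B3 B k by auto
      ultimately show ?thesis by (simp add: c_def divide_simps mult_ac)
    qed
  qed
qed

text \<open>Dirichlet's theorem gives one vector with denominator at most \<open>m\<^sup>2\<close> and errors below
  \<open>1 / m\<close>, hence three independent vectors of that size up to a constant. Their integer
  combinations approximate any prescribed triple of denominator and errors to within the sum of the
  sizes: write the triple as a real combination and round the coefficients.\<close>
lemma covering_scale:
  obtains C where "C \<ge> 1"
    "\<And>m s t. m \<ge> 1 \<Longrightarrow> \<exists>n p q. 0 \<le> n \<and> of_int n \<le> C * (real m)\<^sup>2 \<and>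
       \<bar>of_int n * \<theta> - of_int p - s\<bar> \<le> C / real m \<and> \<bar>of_int n * \<theta>\<^sup>2 - of_int q - t\<bar> \<le> C / real m"
proof -
  obtain B where B: "B \<ge> 1"
    and ind: "\<And>k p q \<epsilon>. (k, p, q) \<noteq> (0, 0, 0) \<Longrightarrow> approx \<epsilon> (k, p, q) \<Longrightarrow>
       \<exists>k1 p1 q1 k2 p2 q2. det3 (k, p, q) (k1, p1, q1) (k2, p2, q2) \<noteq> 0 \<and>
         \<bar>real_of_int k1\<bar> \<le> B * (\<bar>of_int k\<bar> + \<epsilon>) \<and> \<bar>real_of_int k2\<bar> \<le> B * (\<bar>of_int k\<bar> + \<epsilon>) \<and>
         approx (B * \<epsilon>) (k1, p1, q1) \<and> approx (B * \<epsilon>) (k2, p2, q2)"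
    using independent_approximations by metis
  have "\<exists>n p q. 0 \<le> n \<and> of_int n \<le> 12 * B * (real m)\<^sup>2 \<and>
       \<bar>of_int n * \<theta> - of_int p - s\<bar> \<le> 12 * B / real m \<and> \<bar>of_int n * \<theta>\<^sup>2 - of_int q - t\<bar> \<le> 12 * B / real m"
    if m: "m \<ge> 1" for m :: nat and s t
  proof -
    obtain k0 pp where k0: "0 < k0" "k0 \<le> int (m ^ 2)"
      "\<And>i::nat. i < 2 \<Longrightarrow> \<bar>of_int k0 * (if i = 0 then \<theta> else \<theta>\<^sup>2) - of_int (pp i)\<bar> < 1 / real m"
      using Dirichlet_approx_simult[of m 2 "\<lambda>i. if i = 0 then \<theta> else \<theta>\<^sup>2"] m by auto
    define p0 q0 where "p0 = pp 0" and "q0 = pp 1"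
    have a0: "approx (1 / real m) (k0, p0, q0)"
      using k0(3)[of 0] k0(3)[of 1] by (simp add: p0_def q0_def)
    have nz: "(k0, p0, q0) \<noteq> (0, 0, 0)" using k0 by simp
    from ind[OF nz a0] obtain k1 p1 q1 k2 p2 q2 where d: "det3 (k0, p0, q0) (k1, p1, q1) (k2, p2, q2) \<noteq> 0"
       and bd: "\<bar>real_of_int k1\<bar> \<le> B * (\<bar>of_int k0\<bar> + 1 / real m)" "\<bar>real_of_int k2\<bar> \<le> B * (\<bar>of_int k0\<bar> + 1 / real m)"
       "approx (B * (1 / real m)) (k1, p1, q1)" "approx (B * (1 / real m)) (k2, p2, q2)" by blast
    define R where "R = 2 * B * (real m)\<^sup>2"
    have m2: "1 \<le> (real m)\<^sup>2" using m by simp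
    have k0m: "real_of_int k0 \<le> (real m)\<^sup>2" using k0(2)
      by (metis of_int_le_iff of_int_of_nat_eq of_nat_power)
    have "1 / real m \<le> 1" using m by simp
    then have "\<bar>of_int k0\<bar> + 1 / real m \<le> 2 * (real m)\<^sup>2" using k0(1) k0m m2 by simp
    then have "B * (\<bar>of_int k0\<bar> + 1 / real m) \<le> R"
      using mult_left_mono[of "\<bar>of_int k0\<bar> + 1 / real m" "2 * (real m)\<^sup>2" B] B by (simp add: R_def)
    moreover have "\<bar>of_int k0\<bar> \<le> B * (\<bar>of_int k0\<bar> + 1 / real m)"
    proof -
      have "\<bar>of_int k0\<bar> \<le> 1 * (\<bar>of_int k0\<bar> + 1 / real m)" by simp
      also have "\<dots> \<le> B * (\<bar>of_int k0\<bar> + 1 / real m)" using B by (intro mult_right_mono) auto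
      finally show ?thesis .
    qed
    ultimately have R: "\<bar>real_of_int k0\<bar> \<le> R" "\<bar>real_of_int k1\<bar> \<le> R" "\<bar>real_of_int k2\<bar> \<le> R"
      using bd by linarith+
    define r where "r = B * (1 / real m)"
    have "1 / real m \<le> r" unfolding r_def using mult_right_mono[OF B, of "1 / real m"] by simp
    then have ap: "approx r (k0, p0, q0)" "approx r (k1, p1, q1)" "approx r (k2, p2, q2)"
      using a0 bd by (auto simp: r_def)
    define x0 x1 x2 where "x0 = of_int k0 * \<theta> - of_int p0" and "x1 = of_int k1 * \<theta> - of_int p1"
      and "x2 = of_int k2 * \<theta> - of_int p2"
    define y0 y1 y2 where "y0 = of_int k0 * \<theta>\<^sup>2 - of_int q0" and "y1 = of_int k1 * \<theta>\<^sup>2 - of_int q1"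
      and "y2 = of_int k2 * \<theta>\<^sup>2 - of_int q2"
    have xy: "\<bar>x0\<bar> \<le> r" "\<bar>x1\<bar> \<le> r" "\<bar>x2\<bar> \<le> r" "\<bar>y0\<bar> \<le> r" "\<bar>y1\<bar> \<le> r" "\<bar>y2\<bar> \<le> r"
      using ap by (simp_all add: x0_def x1_def x2_def y0_def y1_def y2_def)
    have "real_of_int (det3 (k0, p0, q0) (k1, p1, q1) (k2, p2, q2)) =
       det3 (real_of_int k0, real_of_int p0, real_of_int q0)
         (real_of_int k1, real_of_int p1, real_of_int q1) (real_of_int k2, real_of_int p2, real_of_int q2)"
      by simp
    also have "\<dots> = det3 (of_int k0, x0, y0) (of_int k1, x1, y1) (of_int k2, x2, y2)"
      unfolding x0_def x1_def x2_def y0_def y1_def y2_def by (rule det3_shear)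
    finally have "det3 (of_int k0, x0, y0) (of_int k1, x1, y1) (of_int k2, x2, y2) \<noteq> 0"
      using d by (metis of_int_eq_0_iff)
    \<comment> \<open>The target denominator \<open>3 R\<close> is as large as the rounding error, so that \<open>n\<close> is nonnegative.\<close>
    then obtain l0 l1 l2 where l: "l0 * of_int k0 + l1 * of_int k1 + l2 * of_int k2 = 3 * R"
      "l0 * x0 + l1 * x1 + l2 * x2 = s" "l0 * y0 + l1 * y1 + l2 * y2 = t"
      by (rule cramer3)
    define n0 n1 n2 where "n0 = \<lfloor>l0\<rfloor>" and "n1 = \<lfloor>l1\<rfloor>" and "n2 = \<lfloor>l2\<rfloor>"
    have round: "\<bar>(of_int n0 * z0 + of_int n1 * z1 + of_int n2 * z2) - (l0 * z0 + l1 * z1 + l2 * z2)\<bar> \<le> 3 * M"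
      if "\<bar>z0\<bar> \<le> M" "\<bar>z1\<bar> \<le> M" "\<bar>z2\<bar> \<le> M" for z0 z1 z2 M
    proof -
      have summand: "\<bar>(of_int \<lfloor>l\<rfloor> - l) * z\<bar> \<le> M" if "\<bar>z\<bar> \<le> M" for l z
      proof -
        have "\<bar>of_int \<lfloor>l\<rfloor> - l\<bar> \<le> 1" by linarith
        then have "\<bar>of_int \<lfloor>l\<rfloor> - l\<bar> * \<bar>z\<bar> \<le> 1 * M" using that by (intro mult_mono) auto
        then show ?thesis by (simp add: abs_mult)
      qed
      have "(of_int n0 * z0 + of_int n1 * z1 + of_int n2 * z2) - (l0 * z0 + l1 * z1 + l2 * z2)
        = (of_int n0 - l0) * z0 + (of_int n1 - l1) * z1 + (of_int n2 - l2) * z2"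
        by (simp add: algebra_simps)
      then show ?thesis
        using summand[OF that(1), of l0] summand[OF that(2), of l1] summand[OF that(3), of l2]
        unfolding n0_def n1_def n2_def by linarith
    qed
    define n p q where "n = n0 * k0 + n1 * k1 + n2 * k2" and "p = n0 * p0 + n1 * p1 + n2 * p2"
      and "q = n0 * q0 + n1 * q1 + n2 * q2"
    have "\<bar>of_int n - 3 * R\<bar> \<le> 3 * R" using round[OF R] unfolding l n_def by simp
    then have "0 \<le> n" "of_int n \<le> 6 * R" by linarith+
    moreover have "of_int n * \<theta> - of_int p = of_int n0 * x0 + of_int n1 * x1 + of_int n2 * x2"
      by (simp add: n_def p_def x0_def x1_def x2_def algebra_simps)
    then have "\<bar>of_int n * \<theta> - of_int p - s\<bar> \<le> 3 * r" using round[OF xy(1-3)] unfolding l by simp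
    moreover have "of_int n * \<theta>\<^sup>2 - of_int q = of_int n0 * y0 + of_int n1 * y1 + of_int n2 * y2"
      by (simp add: n_def q_def y0_def y1_def y2_def algebra_simps)
    then have "\<bar>of_int n * \<theta>\<^sup>2 - of_int q - t\<bar> \<le> 3 * r" using round[OF xy(4-6)] unfolding l by simp
    moreover have "0 \<le> r" using ap by auto
    then have "3 * r \<le> 12 * B / real m" by (simp add: r_def)
    moreover have "6 * R = 12 * B * (real m)\<^sup>2" by (simp add: R_def)
    ultimately have "0 \<le> n \<and> of_int n \<le> 12 * B * (real m)\<^sup>2 \<and> \<bar>of_int n * \<theta> - of_int p - s\<bar> \<le> 12 * B / real m \<and>
        \<bar>of_int n * \<theta>\<^sup>2 - of_int q - t\<bar> \<le> 12 * B / real m" by linarith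
    then show ?thesis by blast
  qed
  moreover have "1 \<le> 12 * B" using B by simp
  ultimately show thesis using that by blast
qed

text \<open>To keep \<open>n\<close> below \<open>N\<close>, apply the preceding lemma with \<open>m\<close> about
  \<open>sqrt (N / (2 C0))\<close>. If \<open>N\<close> is too small for that, \<open>n = 0\<close> already works for a
  constant large enough.\<close>
lemma covering:
  obtains C where "C > 0"
    "\<And>N s t. N \<ge> 1 \<Longrightarrow> \<exists>n p q. n < N \<and>
       \<bar>of_nat n * \<theta> - of_int p - s\<bar> \<le> C / sqrt (of_nat N) \<and> \<bar>of_nat n * \<theta>\<^sup>2 - of_int q - t\<bar> \<le> C / sqrt (of_nat N)"
proof -
  obtain C0 where C0: "C0 \<ge> 1"
    and cov: "\<And>m s t. m \<ge> 1 \<Longrightarrow> \<exists>n p q. 0 \<le> n \<and> of_int n \<le> C0 * (real m)\<^sup>2 \<and>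
       \<bar>of_int n * \<theta> - of_int p - s\<bar> \<le> C0 / real m \<and> \<bar>of_int n * \<theta>\<^sup>2 - of_int q - t\<bar> \<le> C0 / real m"
    using covering_scale by metis
  \<comment> \<open>The number \<open>8 C0\<close> is the threshold for \<open>N\<close> that makes \<open>z\<close> below at least \<open>2\<close>,
    so that rounding \<open>z\<close> down loses at most a factor 2.\<close>
  define C where "C = C0 * sqrt (8 * C0)"
  have "sqrt (8 * C0) \<ge> 1" using C0 by simp
  then have C: "C > 0" "sqrt (8 * C0) \<le> C" using C0 by (auto simp: C_def)
  have "\<exists>n p q. n < N \<and>
       \<bar>of_nat n * \<theta> - of_int p - s\<bar> \<le> C / sqrt (of_nat N) \<and> \<bar>of_nat n * \<theta>\<^sup>2 - of_int q - t\<bar> \<le> C / sqrt (of_nat N)"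
    if N: "N \<ge> 1" for N :: nat and s t
  proof (cases "real N \<le> 8 * C0")
    case True
    have "sqrt (real N) \<le> C"
      using order_trans[OF real_sqrt_le_mono[OF True] C(2)] .
    then have "1 \<le> C / sqrt (real N)" using N by (simp add: le_divide_eq)
    moreover have "\<bar>of_nat 0 * \<theta> - of_int (- \<lfloor>s\<rfloor>) - s\<bar> \<le> 1" "\<bar>of_nat 0 * \<theta>\<^sup>2 - of_int (- \<lfloor>t\<rfloor>) - t\<bar> \<le> 1"
      unfolding of_nat_0 mult_zero_left of_int_minus by linarith+
    ultimately have "0 < N \<and> \<bar>of_nat 0 * \<theta> - of_int (- \<lfloor>s\<rfloor>) - s\<bar> \<le> C / sqrt (real N) \<and>
        \<bar>of_nat 0 * \<theta>\<^sup>2 - of_int (- \<lfloor>t\<rfloor>) - t\<bar> \<le> C / sqrt (real N)"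
      using N by linarith
    then show ?thesis by blast
  next
    case False
    define z where "z = sqrt (real N / (2 * C0))"
    define m where "m = nat \<lfloor>z\<rfloor>"
    have "2 \<le> z"
      unfolding z_def using False C0 by (intro real_le_rsqrt) (simp add: field_simps)
    then have m: "m \<ge> 1" "real m \<le> z" "z / 2 \<le> real m" unfolding m_def by linarith+
    have "C0 * (real m)\<^sup>2 \<le> C0 * z\<^sup>2" using m C0 by (intro mult_left_mono power_mono) auto
    also have "\<dots> = real N / 2" using C0 by (simp add: z_def)
    also have "\<dots> < real N" using N by simp
    finally have lt: "C0 * (real m)\<^sup>2 < real N" .
    have "C0 / real m \<le> C0 / (z / 2)" using m \<open>2 \<le> z\<close> C0 by (intro divide_left_mono) auto
    also have "\<dots> = C / sqrt (of_nat N)"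
    proof -
      have "sqrt (8 * C0) = 2 * sqrt (2 * C0)"
        using real_sqrt_mult[of 4 "2 * C0"] by simp
      then show ?thesis by (simp add: C_def z_def real_sqrt_divide)
    qed
    finally have le: "C0 / real m \<le> C / sqrt (of_nat N)" .
    obtain n p q where n: "0 \<le> n" "of_int n \<le> C0 * (real m)\<^sup>2"
       "\<bar>of_int n * \<theta> - of_int p - s\<bar> \<le> C0 / real m" "\<bar>of_int n * \<theta>\<^sup>2 - of_int q - t\<bar> \<le> C0 / real m"
      using cov[OF m(1)] by blast
    have "real (nat n) = of_int n" using n(1) by simp
    moreover from this have "nat n < N" using n(2) lt by linarith
    ultimately have "nat n < N \<and> \<bar>of_nat (nat n) * \<theta> - of_int p - s\<bar> \<le> C / sqrt (real N) \<and>
        \<bar>of_nat (nat n) * \<theta>\<^sup>2 - of_int q - t\<bar> \<le> C / sqrt (real N)"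
      using n(3,4) le by simp
    then show ?thesis by blast
  qed
  with C(1) that show thesis by blast
qed


text \<open>The integer matrix with rows \<open>(a1, b1)\<close> and \<open>(a2, b2)\<close> takes
  \<open>(\<theta>, \<theta>\<^sup>2)\<close> to the pair of coefficients. Its adjugate turns approximations of the pair
  with denominator \<open>k\<close> into approximations of \<open>(\<theta>, \<theta>\<^sup>2)\<close> with denominator
  \<open>\<Delta> k\<close>, where \<open>\<Delta>\<close> is the determinant.\<close>
lemma pair_badly_approximable:
  assumes "a1 * b2 - a2 * b1 \<noteq> (0::int)"
  obtains c where "c > 0"
    "\<And>k p q \<epsilon>. k \<noteq> 0 \<Longrightarrow> \<bar>of_int k * kron_coeff \<theta> a1 b1 - of_int p\<bar> \<le> \<epsilon> \<Longrightarrow>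
       \<bar>of_int k * kron_coeff \<theta> a2 b2 - of_int q\<bar> \<le> \<epsilon> \<Longrightarrow> c / sqrt \<bar>of_int k\<bar> \<le> \<epsilon>"
proof -
  obtain c0 where c0: "c0 > 0"
    "\<And>k p q \<epsilon>. k \<noteq> 0 \<Longrightarrow> approx \<epsilon> (k, p, q) \<Longrightarrow> c0 / sqrt \<bar>of_int k\<bar> \<le> \<epsilon>"
    using badly_approximable by metis
  define \<Delta> where "\<Delta> = a1 * b2 - a2 * b1"
  have \<Delta>: "\<Delta> \<noteq> 0" using assms by (simp add: \<Delta>_def)
  define G where "G = 1 + \<bar>real_of_int a1\<bar> + \<bar>real_of_int a2\<bar> + \<bar>real_of_int b1\<bar> + \<bar>real_of_int b2\<bar>"
  have G: "G > 0" by (simp add: G_def)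
  define c where "c = c0 / (sqrt \<bar>of_int \<Delta>\<bar> * G)"
  show thesis
  proof (rule that)
    show "c > 0" using c0(1) G \<Delta> by (simp add: c_def)
    fix k p q \<epsilon>
    assume k: "k \<noteq> 0" and small: "\<bar>of_int k * kron_coeff \<theta> a1 b1 - of_int p\<bar> \<le> \<epsilon>"
      "\<bar>of_int k * kron_coeff \<theta> a2 b2 - of_int q\<bar> \<le> \<epsilon>"
    define x y where "x = of_int k * kron_coeff \<theta> a1 b1 - of_int p"
      and "y = of_int k * kron_coeff \<theta> a2 b2 - of_int q"
    have e: "\<epsilon> \<ge> 0" using small by linarith
    have tri: "\<bar>s * x - t * y\<bar> \<le> (\<bar>s\<bar> + \<bar>t\<bar>) * \<epsilon>" for s t
    proof -
      have "\<bar>s * x\<bar> \<le> \<bar>s\<bar> * \<epsilon>" "\<bar>t * y\<bar> \<le> \<bar>t\<bar> * \<epsilon>"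
        unfolding abs_mult using small by (auto simp: x_def y_def intro: mult_left_mono)
      then show ?thesis by (simp add: algebra_simps)
    qed
    have "of_int (\<Delta> * k) * \<theta> - of_int (b2 * p - b1 * q) = of_int b2 * x - of_int b1 * y"
      by (simp add: x_def y_def \<Delta>_def kron_coeff_def algebra_simps)
    also have "\<bar>\<dots>\<bar> \<le> (\<bar>of_int b2\<bar> + \<bar>of_int b1\<bar>) * \<epsilon>" by (rule tri)
    also have "\<dots> \<le> G * \<epsilon>" using e by (intro mult_right_mono) (auto simp: G_def)
    finally have 1: "\<bar>of_int (\<Delta> * k) * \<theta> - of_int (b2 * p - b1 * q)\<bar> \<le> G * \<epsilon>" .
    have "of_int (\<Delta> * k) * \<theta>\<^sup>2 - of_int (a1 * q - a2 * p) = of_int (- a2) * x - of_int (- a1) * y"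
      by (simp add: x_def y_def \<Delta>_def kron_coeff_def algebra_simps)
    also have "\<bar>\<dots>\<bar> \<le> (\<bar>of_int (- a2)\<bar> + \<bar>of_int (- a1)\<bar>) * \<epsilon>" by (rule tri)
    also have "\<dots> \<le> G * \<epsilon>" using e by (intro mult_right_mono) (auto simp: G_def)
    finally have 2: "\<bar>of_int (\<Delta> * k) * \<theta>\<^sup>2 - of_int (a1 * q - a2 * p)\<bar> \<le> G * \<epsilon>" .
    have "approx (G * \<epsilon>) (\<Delta> * k, b2 * p - b1 * q, a1 * q - a2 * p)"
      using 1 2 by (simp only: approx.simps)
    then have "c0 / sqrt \<bar>of_int (\<Delta> * k)\<bar> \<le> G * \<epsilon>"
      by (rule c0(2)[rotated]) (use k \<Delta> in simp)
    then have "c0 / sqrt \<bar>of_int (\<Delta> * k)\<bar> / G \<le> \<epsilon>" using G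
      by (subst pos_divide_le_eq) (simp_all add: mult.commute)
    also have "c0 / sqrt \<bar>of_int (\<Delta> * k)\<bar> / G = c / sqrt \<bar>of_int k\<bar>"
      by (simp add: c_def abs_mult real_sqrt_mult)
    finally show "c / sqrt \<bar>of_int k\<bar> \<le> \<epsilon>" .
  qed
qed

text \<open>The same matrix acts on the torus, so a target for the pair is pulled back to the target
  \<open>(s', t')\<close> for \<open>(\<theta>, \<theta>\<^sup>2)\<close> and the approximation found there is pushed
  forward.\<close>
lemma pair_covering:
  assumes "a1 * b2 - a2 * b1 \<noteq> (0::int)"
  obtains C where "C > 0"
    "\<And>N s t. N \<ge> 1 \<Longrightarrow> \<exists>n p q. n < N \<and>
       \<bar>of_nat n * kron_coeff \<theta> a1 b1 - of_int p - s\<bar> \<le> C / sqrt (of_nat N) \<and>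
       \<bar>of_nat n * kron_coeff \<theta> a2 b2 - of_int q - t\<bar> \<le> C / sqrt (of_nat N)"
proof -
  obtain C0 where C0: "C0 > 0"
    and cov: "\<And>N s t. N \<ge> 1 \<Longrightarrow> \<exists>n p q. n < N \<and>
       \<bar>of_nat n * \<theta> - of_int p - s\<bar> \<le> C0 / sqrt (of_nat N) \<and> \<bar>of_nat n * \<theta>\<^sup>2 - of_int q - t\<bar> \<le> C0 / sqrt (of_nat N)"
    using covering by metis
  define \<Delta> where "\<Delta> = real_of_int (a1 * b2 - a2 * b1)"
  have \<Delta>: "\<Delta> \<noteq> 0" using assms unfolding \<Delta>_def by linarith
  have \<Delta>_eq: "\<Delta> = of_int a1 * of_int b2 - of_int a2 * of_int b1" by (simp add: \<Delta>_def)
  define G where "G = 1 + \<bar>real_of_int a1\<bar> + \<bar>real_of_int a2\<bar> + \<bar>real_of_int b1\<bar> + \<bar>real_of_int b2\<bar>"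
  have G: "G > 0" by (simp add: G_def)
  show thesis
  proof (rule that)
    show "G * C0 > 0" using G C0 by simp
    fix N :: nat and s t :: real
    assume N: "N \<ge> 1"
    define s' t' where "s' = (of_int b2 * s - of_int b1 * t) / \<Delta>" and "t' = (of_int a1 * t - of_int a2 * s) / \<Delta>"
    have st: "of_int a1 * s' + of_int b1 * t' = s" "of_int a2 * s' + of_int b2 * t' = t"
      using \<Delta> by (simp_all add: s'_def t'_def \<Delta>_eq divide_simps) (simp_all add: algebra_simps)
    define \<epsilon> where "\<epsilon> = C0 / sqrt (real N)"
    have e: "\<epsilon> \<ge> 0" using C0 by (simp add: \<epsilon>_def)
    obtain n p q where n: "n < N" and small: "\<bar>of_nat n * \<theta> - of_int p - s'\<bar> \<le> \<epsilon>"
      "\<bar>of_nat n * \<theta>\<^sup>2 - of_int q - t'\<bar> \<le> \<epsilon>"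
      using cov[OF N] unfolding \<epsilon>_def by blast
    define x y where "x = of_nat n * \<theta> - of_int p - s'" and "y = of_nat n * \<theta>\<^sup>2 - of_int q - t'"
    have tri: "\<bar>u * x + v * y\<bar> \<le> (\<bar>u\<bar> + \<bar>v\<bar>) * \<epsilon>" for u v
    proof -
      have "\<bar>u * x\<bar> \<le> \<bar>u\<bar> * \<epsilon>" "\<bar>v * y\<bar> \<le> \<bar>v\<bar> * \<epsilon>"
        unfolding abs_mult using small by (auto simp: x_def y_def intro: mult_left_mono)
      then show ?thesis by (simp add: algebra_simps)
    qed
    have "of_nat n * kron_coeff \<theta> a1 b1 - of_int (a1 * p + b1 * q) - s = of_int a1 * x + of_int b1 * y"
      by (simp add: x_def y_def st(1)[symmetric] kron_coeff_def algebra_simps)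
    also have "\<bar>\<dots>\<bar> \<le> (\<bar>of_int a1\<bar> + \<bar>of_int b1\<bar>) * \<epsilon>" by (rule tri)
    also have "\<dots> \<le> G * \<epsilon>" using e by (intro mult_right_mono) (auto simp: G_def)
    finally have 1: "\<bar>of_nat n * kron_coeff \<theta> a1 b1 - of_int (a1 * p + b1 * q) - s\<bar> \<le> G * C0 / sqrt (real N)"
      by (simp add: \<epsilon>_def)
    have "of_nat n * kron_coeff \<theta> a2 b2 - of_int (a2 * p + b2 * q) - t = of_int a2 * x + of_int b2 * y"
      by (simp add: x_def y_def st(2)[symmetric] kron_coeff_def algebra_simps)
    also have "\<bar>\<dots>\<bar> \<le> (\<bar>of_int a2\<bar> + \<bar>of_int b2\<bar>) * \<epsilon>" by (rule tri)
    also have "\<dots> \<le> G * \<epsilon>" using e by (intro mult_right_mono) (auto simp: G_def)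
    finally have 2: "\<bar>of_nat n * kron_coeff \<theta> a2 b2 - of_int (a2 * p + b2 * q) - t\<bar> \<le> G * C0 / sqrt (real N)"
      by (simp add: \<epsilon>_def)
    show "\<exists>n p q. n < N \<and>
       \<bar>of_nat n * kron_coeff \<theta> a1 b1 - of_int p - s\<bar> \<le> G * C0 / sqrt (of_nat N) \<and>
       \<bar>of_nat n * kron_coeff \<theta> a2 b2 - of_int q - t\<bar> \<le> G * C0 / sqrt (of_nat N)"
      using n 1 2 by blast
  qed
qed

end

section \<open>Separation and covering in the unit square\<close>

definition kron_pair :: "real \<Rightarrow> real \<Rightarrow> nat \<Rightarrow> real \<times> real" where
  "kron_pair \<alpha> \<beta> n = (frac (of_nat n * \<alpha>), frac (of_nat n * \<beta>))"

text \<open>The difference of two points of the sequence is an integer translate of the point with index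
  \<open>n - m < N\<close>, so bad approximability bounds all distances from below.\<close>
lemma sep_radius_kron_pair:
  assumes approx: "\<And>k p q \<epsilon>. k \<noteq> 0 \<Longrightarrow> \<bar>of_int k * \<alpha> - of_int p\<bar> \<le> \<epsilon> \<Longrightarrow>
       \<bar>of_int k * \<beta> - of_int q\<bar> \<le> \<epsilon> \<Longrightarrow> c / sqrt \<bar>of_int k\<bar> \<le> \<epsilon>"
    and c: "c > 0" and N: "N \<ge> 2"
  shows "c / 2 / sqrt (real N) \<le> sep_radius (initial_segment (kron_pair \<alpha> \<beta>) N)"
proof -
  let ?P = "initial_segment (kron_pair \<alpha> \<beta>) N"
  let ?S = "{dist (?P ! m) (?P ! n) | m n. m < n \<and> n < length ?P}"
  have len: "length ?P = N" by (simp add: initial_segment_def)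
  have nth: "?P ! n = kron_pair \<alpha> \<beta> n" if "n < N" for n
    using that by (simp add: initial_segment_def)
  have "?S \<subseteq> (\<lambda>(m, n). dist (?P ! m) (?P ! n)) ` ({..<N} \<times> {..<N})"
    unfolding len by force
  then have fin: "finite ?S" by (rule finite_subset) simp
  have "dist (?P ! 0) (?P ! 1) \<in> ?S" unfolding len using N by force
  then have ne: "?S \<noteq> {}" by blast
  have "c / sqrt (real N) \<le> Min ?S"
  proof (rule Min.boundedI[OF fin ne])
    fix r assume "r \<in> ?S"
    then obtain m n where mn: "m < n" "n < N" and r: "r = dist (?P ! m) (?P ! n)"
      unfolding len by blast
    have frac_diff: "\<bar>of_int (int n - int m) * \<gamma> - of_int (\<lfloor>of_nat n * \<gamma>\<rfloor> - \<lfloor>of_nat m * \<gamma>\<rfloor>)\<bar>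
        = dist (frac (of_nat m * \<gamma>)) (frac (of_nat n * \<gamma>))" for \<gamma>
      by (simp add: frac_def dist_real_def algebra_simps abs_minus_commute)
    have r': "r = dist (kron_pair \<alpha> \<beta> m) (kron_pair \<alpha> \<beta> n)" using r mn nth by simp
    have "c / sqrt \<bar>of_int (int n - int m)\<bar> \<le> r"
    proof (rule approx)
      show "int n - int m \<noteq> 0" using mn by simp
      show "\<bar>of_int (int n - int m) * \<alpha> - of_int (\<lfloor>of_nat n * \<alpha>\<rfloor> - \<lfloor>of_nat m * \<alpha>\<rfloor>)\<bar> \<le> r"
        unfolding frac_diff r' kron_pair_def
        using dist_fst_le[of "(frac (real m * \<alpha>), frac (real m * \<beta>))" "(frac (real n * \<alpha>), frac (real n * \<beta>))"]
        by simp
      show "\<bar>of_int (int n - int m) * \<beta> - of_int (\<lfloor>of_nat n * \<beta>\<rfloor> - \<lfloor>of_nat m * \<beta>\<rfloor>)\<bar> \<le> r"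
        unfolding frac_diff r' kron_pair_def
        using dist_snd_le[of "(frac (real m * \<alpha>), frac (real m * \<beta>))" "(frac (real n * \<alpha>), frac (real n * \<beta>))"]
        by simp
    qed
    moreover have "c / sqrt (real N) \<le> c / sqrt \<bar>of_int (int n - int m)\<bar>"
      using mn c by (intro divide_left_mono real_sqrt_le_mono mult_pos_pos) auto
    ultimately show "c / sqrt (real N) \<le> r" by linarith
  qed
  then show ?thesis unfolding sep_radius_def by simp
qed

text \<open>Closeness modulo \<open>1\<close> is turned into Euclidean closeness in \<open>[0, 1)\<close>: move the target
  away from the boundary so that the approximating number lies in \<open>[0, 1)\<close> without any further
  reduction. For \<open>\<delta> > 1 / 3\<close> the conclusion is trivial.\<close>
lemma frac_near_target:
  fixes y \<delta> :: real
  assumes "0 \<le> y" "y < 1" "\<delta> > 0"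
  obtains s where "\<And>z p. \<bar>z - of_int p - s\<bar> \<le> \<delta> \<Longrightarrow> \<bar>y - frac z\<bar> \<le> 3 * \<delta>"
proof (cases "\<delta> \<le> 1 / 3")
  case True
  define s where "s = max \<delta> (min y (1 - 2 * \<delta>))"
  have s: "\<delta> \<le> s" "s \<le> 1 - 2 * \<delta>" "\<bar>y - s\<bar> \<le> 2 * \<delta>"
    using True assms by (auto simp: s_def)
  show thesis
  proof (rule that[of s])
    fix z p assume z: "\<bar>z - of_int p - s\<bar> \<le> \<delta>"
    have "0 \<le> z - of_int p" "z - of_int p < 1" using z s assms(3) by linarith+
    then have "\<lfloor>z\<rfloor> = p" by linarith
    then show "\<bar>y - frac z\<bar> \<le> 3 * \<delta>" unfolding frac_def using z s by linarith
  qed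
next
  case False
  show thesis
  proof (rule that[of 0])
    fix z :: real and p :: int
    show "\<bar>y - frac z\<bar> \<le> 3 * \<delta>"
      using False assms frac_ge_0[of z] frac_lt_1[of z] by linarith
  qed
qed

lemma fill_dist_kron_pair:
  assumes cov: "\<And>s t. \<exists>n p q. n < N \<and> \<bar>of_nat n * \<alpha> - of_int p - s\<bar> \<le> \<delta> \<and> \<bar>of_nat n * \<beta> - of_int q - t\<bar> \<le> \<delta>"
    and \<delta>: "\<delta> > 0"
  shows "fill_dist (initial_segment (kron_pair \<alpha> \<beta>) N) \<le> 6 * \<delta>"
  unfolding fill_dist_def
proof (rule cSUP_least)
  let ?P = "initial_segment (kron_pair \<alpha> \<beta>) N"
  have "(0, 0) \<in> (unit_cube :: (real \<times> real) set)" unfolding unit_cube_prod by simp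
  then show "(unit_cube :: (real \<times> real) set) \<noteq> {}" by blast
  fix y :: "real \<times> real" assume "y \<in> unit_cube"
  then obtain y1 y2 where y: "y = (y1, y2)" "0 \<le> y1" "y1 < 1" "0 \<le> y2" "y2 < 1"
    unfolding unit_cube_prod by auto
  obtain s where s: "\<And>z p. \<bar>z - of_int p - s\<bar> \<le> \<delta> \<Longrightarrow> \<bar>y1 - frac z\<bar> \<le> 3 * \<delta>"
    using frac_near_target[OF y(2,3) \<delta>] by metis
  obtain t where t: "\<And>z p. \<bar>z - of_int p - t\<bar> \<le> \<delta> \<Longrightarrow> \<bar>y2 - frac z\<bar> \<le> 3 * \<delta>"
    using frac_near_target[OF y(4,5) \<delta>] by metis
  obtain n p q where n: "n < N" "\<bar>of_nat n * \<alpha> - of_int p - s\<bar> \<le> \<delta>" "\<bar>of_nat n * \<beta> - of_int q - t\<bar> \<le> \<delta>"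
    using cov by blast
  have len: "length ?P = N" and nth: "?P ! n = kron_pair \<alpha> \<beta> n"
    using n(1) by (simp_all add: initial_segment_def)
  have fin: "finite {dist y (?P ! n) | n. n < length ?P}" by simp
  have "dist y (?P ! n) \<in> {dist y (?P ! n) | n. n < length ?P}" 
    using n(1) len by (intro CollectI exI[of _ n]) simp
  then have "Min {dist y (?P ! n) | n. n < length ?P} \<le> dist y (?P ! n)"
    using fin by (intro Min_le)
  also have "\<dots> \<le> \<bar>y1 - frac (of_nat n * \<alpha>)\<bar> + \<bar>y2 - frac (of_nat n * \<beta>)\<bar>"
    unfolding nth y kron_pair_def dist_Pair_Pair dist_real_def
    by (simp add: sqrt_sum_squares_le_sum_abs)
  also have "\<dots> \<le> 3 * \<delta> + 3 * \<delta>" using s[OF n(2)] t[OF n(3)] by (rule add_mono)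
  finally show "Min {dist y (?P ! n) | n. n < length ?P} \<le> 6 * \<delta>" by simp
qed

lemma mesh_ratio_le:
  assumes "c * r \<le> sep_radius P" "fill_dist P \<le> C * r" "c > 0" "r > 0" "C > 0"
  shows "mesh_ratio P \<le> ereal (C / c)"
proof -
  have pos: "0 < c * r" using assms by simp
  have "fill_dist P / sep_radius P \<le> C * r / (c * r)"
    using assms pos by (intro frac_le) auto
  moreover have "sep_radius P \<noteq> 0" using assms(1) pos by linarith
  ultimately show ?thesis using assms(3,4) by (simp add: mesh_ratio_def)
qed

section \<open>Quasi-uniformity of the two-dimensional projections\<close>

theorem theorem3p3:
  fixes K :: "real set" and \<theta> :: real and d :: nat
    and V :: "nat \<Rightarrow> (rat \<times> rat) set" and a b :: "nat \<Rightarrow> int"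
  assumes "algebraic_int \<theta>"
    and "K = rat_adjoin \<theta>"
    and "cubic_number_field K"
    and "d \<ge> 2"
    and "rat_proj_config d V"
    and "\<And>j. j \<in> {1..d} \<Longrightarrow> canonical_rep (V j) (a j) (b j)"
  shows "(\<forall>i j. 1 \<le> i \<and> i < j \<and> j \<le> d \<longrightarrow>
            quasi_uniform (\<lambda>n. coord_proj i j (kron_point \<theta> d a b n))) \<and>
         (\<exists>c C :: real. c > 0 \<and> C > 0 \<and>
            (\<forall>N\<ge>2. \<forall>i j. 1 \<le> i \<and> i < j \<and> j \<le> d \<longrightarrow>
               sep_radius_proj i j (kron_set \<theta> d a b N) \<ge> c * real N powr (- 1 / 2) \<and>
               fill_dist_proj i j (kron_set \<theta> d a b N) \<le> C * real N powr (- 1 / 2))) \<and>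
         (SUP N\<in>{2..}. Max {mesh_ratio_proj i j (kron_set \<theta> d a b N) | i j.
            1 \<le> i \<and> i < j \<and> j \<le> d}) < (\<infinity> :: ereal)"
proof -
  have cnf: "cubic_number_field (rat_adjoin \<theta>)" using assms(2,3) by simp
  obtain D e0 e1 e2 where rel: "D \<noteq> 0"
    "of_int D * \<theta> ^ 3 = of_int e0 + of_int e1 * \<theta> + of_int e2 * \<theta>\<^sup>2"
    by (rule cubic_number_field_relation[OF cnf])
  interpret cubic_irrational \<theta> D e0 e1 e2
    using cubic_number_field_independent[OF cnf] rel by unfold_locales auto
  define I where "I = {(i, j). 1 \<le> i \<and> i < j \<and> j \<le> d}"
  have "I \<subseteq> {1..d} \<times> {1..d}" by (auto simp: I_def)
  then have finI: "finite I" by (rule finite_subset) simp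
  have "(1, 2) \<in> I" using assms(4) by (simp add: I_def)
  then have neI: "I \<noteq> {}" by blast
  let ?r = "\<lambda>N::nat. real N powr (- 1 / 2)"
  have r: "x / sqrt (real N) = x * ?r N" for x N
  proof -
    have "?r N = 1 / sqrt (real N)"
      using powr_minus_divide[of "real N" "1 / 2"] powr_half_sqrt[of "real N"] by simp
    then show ?thesis by simp
  qed
  have seg: "map (coord_proj i j) (kron_set \<theta> d a b N)
      = initial_segment (kron_pair (kron_coeff \<theta> (a i) (b i)) (kron_coeff \<theta> (a j) (b j))) N"
    if "(i, j) \<in> I" for i j N
    using that by (simp add: I_def kron_set_def initial_segment_def coord_proj_def kron_point_def kron_pair_def)
  \<comment> \<open>Constants for a single pair of coordinates; the finitely many pairs then share a minimum and a
    maximum.\<close>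
  have "\<exists>c C. c > 0 \<and> C > 0 \<and> (\<forall>N\<ge>2. c * ?r N \<le> sep_radius_proj (fst \<iota>) (snd \<iota>) (kron_set \<theta> d a b N) \<and>
      fill_dist_proj (fst \<iota>) (snd \<iota>) (kron_set \<theta> d a b N) \<le> C * ?r N)" if "\<iota> \<in> I" for \<iota>
  proof -
    obtain i j where "\<iota> = (i, j)" by (rule prod.exhaust)
    with that have ij: "\<iota> = (i, j)" "(i, j) \<in> I" by simp_all
    then have mem: "i \<in> {1..d}" "j \<in> {1..d}" "i \<noteq> j" by (auto simp: I_def)
    then have "V i \<noteq> V j" using assms(5) by (auto simp: rat_proj_config_def dest: inj_onD)
    then have \<Delta>: "a i * b j - a j * b i \<noteq> 0"
      using canonical_rep_distinct_iff[OF assms(6)[OF mem(1)] assms(6)[OF mem(2)]] by blast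
    let ?\<alpha> = "kron_coeff \<theta> (a i) (b i)" and ?\<beta> = "kron_coeff \<theta> (a j) (b j)"
    obtain c where c: "c > 0" "\<And>k p q \<epsilon>. k \<noteq> 0 \<Longrightarrow> \<bar>of_int k * ?\<alpha> - of_int p\<bar> \<le> \<epsilon> \<Longrightarrow>
       \<bar>of_int k * ?\<beta> - of_int q\<bar> \<le> \<epsilon> \<Longrightarrow> c / sqrt \<bar>of_int k\<bar> \<le> \<epsilon>"
      using pair_badly_approximable[OF \<Delta>] by metis
    obtain C where C: "C > 0" "\<And>N s t. N \<ge> 1 \<Longrightarrow> \<exists>n p q. n < N \<and>
       \<bar>of_nat n * ?\<alpha> - of_int p - s\<bar> \<le> C / sqrt (of_nat N) \<and> \<bar>of_nat n * ?\<beta> - of_int q - t\<bar> \<le> C / sqrt (of_nat N)"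
      using pair_covering[OF \<Delta>] by metis
    have "c / 2 * ?r N \<le> sep_radius_proj i j (kron_set \<theta> d a b N) \<and>
      fill_dist_proj i j (kron_set \<theta> d a b N) \<le> 6 * C * ?r N" if N: "N \<ge> 2" for N
    proof
      show "c / 2 * ?r N \<le> sep_radius_proj i j (kron_set \<theta> d a b N)"
        unfolding sep_radius_proj_def seg[OF ij(2)] r[symmetric]
        by (rule sep_radius_kron_pair[OF c(2) c(1) N])
      have "fill_dist_proj i j (kron_set \<theta> d a b N) \<le> 6 * (C / sqrt (real N))"
        unfolding fill_dist_proj_def seg[OF ij(2)]
        using C N by (intro fill_dist_kron_pair) auto
      then show "fill_dist_proj i j (kron_set \<theta> d a b N) \<le> 6 * C * ?r N"
        unfolding r by (simp add: mult.assoc)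
    qed
    then show ?thesis unfolding ij(1) fst_conv snd_conv
      using c(1) C(1) by (intro exI[of _ "c / 2"] exI[of _ "6 * C"]) auto
  qed
  then obtain f g where fg: "\<And>\<iota>. \<iota> \<in> I \<Longrightarrow> f \<iota> > 0 \<and> g \<iota> > 0 \<and>
    (\<forall>N\<ge>2. f \<iota> * ?r N \<le> sep_radius_proj (fst \<iota>) (snd \<iota>) (kron_set \<theta> d a b N) \<and>
      fill_dist_proj (fst \<iota>) (snd \<iota>) (kron_set \<theta> d a b N) \<le> g \<iota> * ?r N)"
    by metis
  define c C :: real where "c = Min (f ` I)" and "C = Max (g ` I)"
  have c: "c > 0" and cf: "\<And>\<iota>. \<iota> \<in> I \<Longrightarrow> c \<le> f \<iota>"
    using fg finI neI by (auto simp: c_def)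
  have C: "C > 0" and Cg: "\<And>\<iota>. \<iota> \<in> I \<Longrightarrow> g \<iota> \<le> C"
    using fg finI neI by (auto simp: C_def Max_gr_iff)
  have bounds: "c * ?r N \<le> sep_radius_proj i j (kron_set \<theta> d a b N)"
    "fill_dist_proj i j (kron_set \<theta> d a b N) \<le> C * ?r N" if "(i, j) \<in> I" "N \<ge> 2" for i j N
  proof -
    have "c * ?r N \<le> f (i, j) * ?r N" "g (i, j) * ?r N \<le> C * ?r N"
      using cf[OF that(1)] Cg[OF that(1)] by (auto intro: mult_right_mono)
    moreover have "f (i, j) * ?r N \<le> sep_radius_proj i j (kron_set \<theta> d a b N)"
      "fill_dist_proj i j (kron_set \<theta> d a b N) \<le> g (i, j) * ?r N"
      using fg[OF that(1)] that(2) unfolding fst_conv snd_conv by blast+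
    ultimately show "c * ?r N \<le> sep_radius_proj i j (kron_set \<theta> d a b N)"
      "fill_dist_proj i j (kron_set \<theta> d a b N) \<le> C * ?r N"
      by (blast intro: order_trans)+
  qed
  have ratio: "mesh_ratio_proj i j (kron_set \<theta> d a b N) \<le> ereal (C / c)" if "(i, j) \<in> I" "N \<ge> 2" for i j N
    unfolding mesh_ratio_proj_def
    by (rule mesh_ratio_le[OF bounds(1)[OF that, unfolded sep_radius_proj_def]
          bounds(2)[OF that, unfolded fill_dist_proj_def] c _ C]) (use that in simp)
  have "quasi_uniform (\<lambda>n. coord_proj i j (kron_point \<theta> d a b n))" if "(i, j) \<in> I" for i j
    unfolding quasi_uniform_def
    using ratio[OF that] by (auto simp: mesh_ratio_proj_def kron_set_def initial_segment_def comp_def)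
  moreover have "(SUP N\<in>{2..}. Max {mesh_ratio_proj i j (kron_set \<theta> d a b N) | i j.
            1 \<le> i \<and> i < j \<and> j \<le> d}) \<le> ereal (C / c)"
  proof (rule SUP_least)
    fix N :: nat assume N: "N \<in> {2..}"
    have eq: "{mesh_ratio_proj i j (kron_set \<theta> d a b N) | i j. 1 \<le> i \<and> i < j \<and> j \<le> d}
      = (\<lambda>(i, j). mesh_ratio_proj i j (kron_set \<theta> d a b N)) ` I"
      by (auto simp: I_def)
    show "Max {mesh_ratio_proj i j (kron_set \<theta> d a b N) | i j. 1 \<le> i \<and> i < j \<and> j \<le> d} \<le> ereal (C / c)"
      unfolding eq using finI neI ratio N by (intro Max.boundedI) auto
  qed
  then have "(SUP N\<in>{2..}. Max {mesh_ratio_proj i j (kron_set \<theta> d a b N) | i j.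
            1 \<le> i \<and> i < j \<and> j \<le> d}) < (\<infinity> :: ereal)"
    by (rule order.strict_trans1) simp
  moreover have "(i, j) \<in> I" if "1 \<le> i \<and> i < j \<and> j \<le> d" for i j
    using that by (simp add: I_def)
  ultimately show ?thesis
    using bounds c C by blast
qed

end
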